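(* Let $M$ be a manifold modelled on some convenient (locally convex) topological vector space $E$. Let $\theta\in\Omega^1(M)$ and $\omega\in\Omega^2(M)$. Assume that $\omega$ is degenerate, i.e. for every $p\in M$ the kernel $\{v\in T_pM:\omega_p(v,\cdot)=0\}$ is non-zero. Define $\mathcal{H}:=\ker\theta$ and $\mathcal{V}:=\ker\omega=\{v:\omega(v,\cdot)=0\}$. The following are equivalent: (1) $TM=\mathcal{H}\oplus\mathcal{V}$. (2) $\omega|_{\mathcal{H}}$ is weakly non-degenerate. (3) The map $\flat_{\theta,\omega}\colon\mathfrak{X}(M)\to\Omega^1(M)$, $\flat_{\theta,\omega}(X)=\iota_X\omega+\theta(X)\theta$, is an injective map (homomorphism of $C^\infty(M)$-modules).
   Context: A convenient vector space is a Hausdorff locally convex real topological vector space in which every smooth curve has a smooth antiderivative; smooth maps are those sending smooth curves to smooth curves. $TM$ is the kinematic tangent bundle (equivalence classes of smooth curves), $T'M$ the bundle with fibres the continuous duals $(T_pM)'$; $\mathfrak{X}(M)$ and $\Omega^1(M)$ are their smooth sections. $k$-forms are smooth sections of the bundle of continuous alternating $k$-linear forms on $TM$. $\omega|_{\mathcal{H}}$ is weakly non-degenerate if it has zero kernel on each fibre. (A pair $(\theta,\omega)$ satisfying these conditions is called an almost contact structure.)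
   Formalization: Condition (3) also requires that the map be injective on each fibre T_pM, not only on global vector fields; with injectivity on X(M) alone, (3) does not imply (1) or (2): on M = R take θ = x dx, ω = 0. *)

theory Defs
  imports "HOL-Analysis.Analysis"
begin

section \<open>Convenient vector spaces\<close>

class real_topological_vector_space = real_vector + topological_ab_group_add +
  assumes tendsto_scaleR_Pair:
    "LIM x (nhds r \<times>\<^sub>F nhds a). fst x *\<^sub>R snd x :> nhds (r *\<^sub>R a)"

instance real :: real_topological_vector_space
proof
  fix r a :: real
  show "LIM x (nhds r \<times>\<^sub>F nhds a). fst x *\<^sub>R snd x :> nhds (r *\<^sub>R a)"
    by (intro tendsto_scaleR filterlim_fst filterlim_snd)
qed

text \<open>
  The library's \<open>has_vector_derivative\<close> needs a norm, hence the following version.  In the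
  definition of smoothness \<open>D n\<close> is the \<open>n\<close>-th derivative, and \<open>J\<close> is meant to be open.
\<close>

context real_topological_vector_space
begin

definition has_curve_derivative :: "(real \<Rightarrow> 'a) \<Rightarrow> 'a \<Rightarrow> real \<Rightarrow> bool" where
  "has_curve_derivative c d t \<longleftrightarrow> ((\<lambda>h. (c (t + h) - c t) /\<^sub>R h) \<longlongrightarrow> d) (at 0)"

definition smooth_curve_on :: "real set \<Rightarrow> (real \<Rightarrow> 'a) \<Rightarrow> bool" where
  "smooth_curve_on J c \<longleftrightarrow>
     (\<exists>D. (\<forall>t\<in>J. D 0 t = c t) \<and>
          (\<forall>n::nat. \<forall>t\<in>J. has_curve_derivative (D n) (D (Suc n) t) t))"

abbreviation smooth_curve :: "(real \<Rightarrow> 'a) \<Rightarrow> bool" where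
  "smooth_curve \<equiv> smooth_curve_on UNIV"

end

text \<open>In a class specification \<^const>\<open>convex\<close> is not available and has to be written out.\<close>

class locally_convex_space = real_topological_vector_space + t2_space +
  assumes locally_convex:
    "open U \<Longrightarrow> 0 \<in> U \<Longrightarrow>
       \<exists>V. open V \<and> 0 \<in> V \<and> V \<subseteq> U \<and>
           (\<forall>x\<in>V. \<forall>y\<in>V. \<forall>r\<ge>0. \<forall>s\<ge>0. r + s = 1 \<longrightarrow> r *\<^sub>R x + s *\<^sub>R y \<in> V)"

class convenient_vector_space = locally_convex_space +
  assumes smooth_antiderivative:
    "smooth_curve c \<Longrightarrow> \<exists>C. smooth_curve C \<and> (\<forall>t. has_curve_derivative C (c t) t)"

text \<open>The \<open>c\<^sup>\<infinity>\<close>-topology is the final topology with respect to all smooth curves.\<close>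

definition cinf_open :: "'e::convenient_vector_space set \<Rightarrow> bool" where
  "cinf_open W \<longleftrightarrow> (\<forall>c. smooth_curve c \<longrightarrow> open (c -` W))"

definition smooth_map_on ::
    "'e::convenient_vector_space set \<Rightarrow> ('e \<Rightarrow> 'f::real_topological_vector_space) \<Rightarrow> bool" where
  "smooth_map_on W f \<longleftrightarrow> (\<forall>c. smooth_curve c \<and> range c \<subseteq> W \<longrightarrow> smooth_curve (f \<circ> c))"

section \<open>Spaces of continuous alternating forms\<close>

definition tvs_bounded :: "'e::locally_convex_space set \<Rightarrow> bool" where
  "tvs_bounded B \<longleftrightarrow> (\<forall>U. open U \<and> 0 \<in> U \<longrightarrow> (\<exists>r>0. B \<subseteq> (\<lambda>x. r *\<^sub>R x) ` U))"

definition continuous_1_forms :: "('e::locally_convex_space \<Rightarrow> real) set" where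
  "continuous_1_forms = {a. linear a \<and> continuous_on UNIV a}"

definition continuous_2_forms :: "('e::locally_convex_space \<times> 'e \<Rightarrow> real) set" where
  "continuous_2_forms =
     {a. bilinear (curry a) \<and> (\<forall>x. a (x, x) = 0) \<and> continuous_on UNIV a}"

text \<open>
  Smooth curves in a space \<open>L\<close> of forms carrying the topology of uniform convergence on the
  members of \<open>\<B>\<close>.  For \<open>L\<close> the continuous 1-forms and \<open>\<B>\<close> the bounded sets this is the strong
  dual; for 2-forms uniform convergence on products of bounded sets is used.
\<close>

definition smooth_form_curve ::
    "('x \<Rightarrow> real) set \<Rightarrow> 'x set set \<Rightarrow> (real \<Rightarrow> 'x \<Rightarrow> real) \<Rightarrow> bool" where
  "smooth_form_curve L \<B> a \<longleftrightarrow>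
     (\<exists>D. D 0 = a \<and>
        (\<forall>n::nat. \<forall>t. D n t \<in> L \<and>
           (\<forall>B\<in>\<B>. uniform_limit B (\<lambda>h x. (D n (t + h) x - D n t x) / h) (D (Suc n) t) (at 0))))"

definition smooth_1_form_on ::
    "'e::convenient_vector_space set \<Rightarrow> ('e \<Rightarrow> 'e \<Rightarrow> real) \<Rightarrow> bool" where
  "smooth_1_form_on W \<alpha> \<longleftrightarrow> (\<forall>c. smooth_curve c \<and> range c \<subseteq> W \<longrightarrow>
     smooth_form_curve continuous_1_forms {B. tvs_bounded B} (\<alpha> \<circ> c))"

definition smooth_2_form_on ::
    "'e::convenient_vector_space set \<Rightarrow> ('e \<Rightarrow> 'e \<times> 'e \<Rightarrow> real) \<Rightarrow> bool" where
  "smooth_2_form_on W \<beta> \<longleftrightarrow> (\<forall>c. smooth_curve c \<and> range c \<subseteq> W \<longrightarrow>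
     smooth_form_curve continuous_2_forms {B \<times> C |B C. tvs_bounded B \<and> tvs_bounded C} (\<beta> \<circ> c))"

section \<open>Manifolds\<close>

text \<open>A chart is a pair \<open>(U, u)\<close>; the values of \<open>u\<close> outside \<open>U\<close> are irrelevant.\<close>

type_synonym ('m, 'e) chart = "'m set \<times> ('m \<Rightarrow> 'e)"

definition convenient_manifold ::
    "'m set \<Rightarrow> ('m, 'e::convenient_vector_space) chart set \<Rightarrow> bool" where
  "convenient_manifold M A \<longleftrightarrow>
     (\<Union>(U, u)\<in>A. U) = M \<and>
     (\<forall>(U, u)\<in>A. inj_on u U \<and> cinf_open (u ` U)) \<and>
     (\<forall>(U, u)\<in>A. \<forall>(V, v)\<in>A.
        cinf_open (u ` (U \<inter> V)) \<and> smooth_map_on (u ` (U \<inter> V)) (v \<circ> inv_into U u))"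

definition smooth_curve_in ::
    "'m set \<Rightarrow> ('m, 'e::convenient_vector_space) chart set \<Rightarrow> (real \<Rightarrow> 'm) \<Rightarrow> bool" where
  "smooth_curve_in M A c \<longleftrightarrow> range c \<subseteq> M \<and>
     (\<forall>t. \<forall>(U, u)\<in>A. c t \<in> U \<longrightarrow>
        (\<exists>J. open J \<and> t \<in> J \<and> c ` J \<subseteq> U \<and> smooth_curve_on J (u \<circ> c)))"

definition smooth_functions ::
    "'m set \<Rightarrow> ('m, 'e::convenient_vector_space) chart set \<Rightarrow> ('m \<Rightarrow> real) set" where
  "smooth_functions M A = {f. \<forall>(U, u)\<in>A. smooth_map_on (u ` U) (f \<circ> inv_into U u)}"

section \<open>The kinematic tangent bundle\<close>

text \<open>
  Two curves through \<open>p\<close> are equivalent if their velocities agree in one, equivalently (by the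
  chain rule for the transition maps) in every, chart around \<open>p\<close>.  A fixed but arbitrary chart
  \<open>chart_at A p\<close> serves to express this, and to transport the vector space structure of the model
  space to the tangent space.  Neither depends on the choice.
\<close>

definition chart_at :: "('m, 'e) chart set \<Rightarrow> 'm \<Rightarrow> ('m, 'e) chart" where
  "chart_at A p = (SOME C. C \<in> A \<and> p \<in> fst C)"

definition curves_at ::
    "'m set \<Rightarrow> ('m, 'e::convenient_vector_space) chart set \<Rightarrow> 'm \<Rightarrow> (real \<Rightarrow> 'm) set" where
  "curves_at M A p = {c. smooth_curve_in M A c \<and> c 0 = p}"

definition same_velocity ::
    "'m set \<Rightarrow> ('m, 'e::convenient_vector_space) chart set \<Rightarrow> 'm
       \<Rightarrow> ((real \<Rightarrow> 'm) \<times> (real \<Rightarrow> 'm)) set" where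
  "same_velocity M A p =
     {(c, e). c \<in> curves_at M A p \<and> e \<in> curves_at M A p \<and>
        (\<exists>y. has_curve_derivative (snd (chart_at A p) \<circ> c) y 0 \<and>
             has_curve_derivative (snd (chart_at A p) \<circ> e) y 0)}"

definition tangent_space ::
    "'m set \<Rightarrow> ('m, 'e::convenient_vector_space) chart set \<Rightarrow> 'm \<Rightarrow> (real \<Rightarrow> 'm) set set" where
  "tangent_space M A p = curves_at M A p // same_velocity M A p"

text \<open>
  The tangent vector at \<open>p\<close> whose coordinate in the chart map \<open>u\<close> is \<open>y\<close>; so
  \<open>(u p, y) \<mapsto> tangent_vector M A u p y\<close> is the inverse of the bundle chart induced by \<open>u\<close>.
\<close>

definition tangent_vector ::
    "'m set \<Rightarrow> ('m, 'e::convenient_vector_space) chart set \<Rightarrow> ('m \<Rightarrow> 'e) \<Rightarrow> 'm \<Rightarrow> 'e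
       \<Rightarrow> (real \<Rightarrow> 'm) set" where
  "tangent_vector M A u p y =
     same_velocity M A p `` {SOME c. c \<in> curves_at M A p \<and> has_curve_derivative (u \<circ> c) y 0}"

definition tangent_coord ::
    "('m, 'e::convenient_vector_space) chart set \<Rightarrow> 'm \<Rightarrow> (real \<Rightarrow> 'm) set \<Rightarrow> 'e" where
  "tangent_coord A p v = (THE y. \<exists>c\<in>v. has_curve_derivative (snd (chart_at A p) \<circ> c) y 0)"

definition tangent_zero ::
    "'m set \<Rightarrow> ('m, 'e::convenient_vector_space) chart set \<Rightarrow> 'm \<Rightarrow> (real \<Rightarrow> 'm) set" where
  "tangent_zero M A p = tangent_vector M A (snd (chart_at A p)) p 0"

definition tangent_add ::
    "'m set \<Rightarrow> ('m, 'e::convenient_vector_space) chart set \<Rightarrow> 'm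
       \<Rightarrow> (real \<Rightarrow> 'm) set \<Rightarrow> (real \<Rightarrow> 'm) set \<Rightarrow> (real \<Rightarrow> 'm) set" where
  "tangent_add M A p v w =
     tangent_vector M A (snd (chart_at A p)) p (tangent_coord A p v + tangent_coord A p w)"

definition tangent_scale ::
    "'m set \<Rightarrow> ('m, 'e::convenient_vector_space) chart set \<Rightarrow> 'm
       \<Rightarrow> real \<Rightarrow> (real \<Rightarrow> 'm) set \<Rightarrow> (real \<Rightarrow> 'm) set" where
  "tangent_scale M A p r v =
     tangent_vector M A (snd (chart_at A p)) p (r *\<^sub>R tangent_coord A p v)"

section \<open>Vector fields and differential forms\<close>

text \<open>Sections are extensional functions, so that equality of sections is equality on \<open>M\<close>.\<close>

type_synonym 'm vfield = "'m \<Rightarrow> (real \<Rightarrow> 'm) set"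
type_synonym 'm form1 = "'m \<Rightarrow> (real \<Rightarrow> 'm) set \<Rightarrow> real"
type_synonym 'm form2 = "'m \<Rightarrow> (real \<Rightarrow> 'm) set \<Rightarrow> (real \<Rightarrow> 'm) set \<Rightarrow> real"

definition vector_fields ::
    "'m set \<Rightarrow> ('m, 'e::convenient_vector_space) chart set \<Rightarrow> 'm vfield set" where
  "vector_fields M A =
     {X. X \<in> (\<Pi>\<^sub>E p\<in>M. tangent_space M A p) \<and>
         (\<forall>(U, u)\<in>A. \<exists>\<xi>. smooth_map_on (u ` U) \<xi> \<and>
            (\<forall>p\<in>U. X p = tangent_vector M A u p (\<xi> (u p))))}"

definition one_forms ::
    "'m set \<Rightarrow> ('m, 'e::convenient_vector_space) chart set \<Rightarrow> 'm form1 set" where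
  "one_forms M A =
     {\<theta>. \<theta> \<in> (\<Pi>\<^sub>E p\<in>M. tangent_space M A p \<rightarrow>\<^sub>E UNIV) \<and>
         (\<forall>(U, u)\<in>A. smooth_1_form_on (u ` U)
            (\<lambda>x y. let p = inv_into U u x in \<theta> p (tangent_vector M A u p y)))}"

definition two_forms ::
    "'m set \<Rightarrow> ('m, 'e::convenient_vector_space) chart set \<Rightarrow> 'm form2 set" where
  "two_forms M A =
     {\<omega>. \<omega> \<in> (\<Pi>\<^sub>E p\<in>M. tangent_space M A p \<rightarrow>\<^sub>E tangent_space M A p \<rightarrow>\<^sub>E UNIV) \<and>
         (\<forall>(U, u)\<in>A. smooth_2_form_on (u ` U)
            (\<lambda>x (y, z). let p = inv_into U u x in
               \<omega> p (tangent_vector M A u p y) (tangent_vector M A u p z)))}"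

definition form_kernel1 ::
    "'m set \<Rightarrow> ('m, 'e::convenient_vector_space) chart set \<Rightarrow> 'm form1 \<Rightarrow> 'm
       \<Rightarrow> (real \<Rightarrow> 'm) set set" where
  "form_kernel1 M A \<theta> p = {v \<in> tangent_space M A p. \<theta> p v = 0}"

definition form_kernel2 ::
    "'m set \<Rightarrow> ('m, 'e::convenient_vector_space) chart set \<Rightarrow> 'm form2 \<Rightarrow> 'm
       \<Rightarrow> (real \<Rightarrow> 'm) set set" where
  "form_kernel2 M A \<omega> p =
     {v \<in> tangent_space M A p. \<forall>w\<in>tangent_space M A p. \<omega> p v w = 0}"

definition degenerate ::
    "'m set \<Rightarrow> ('m, 'e::convenient_vector_space) chart set \<Rightarrow> 'm form2 \<Rightarrow> bool" where
  "degenerate M A \<omega> \<longleftrightarrow> (\<forall>p\<in>M. form_kernel2 M A \<omega> p \<noteq> {tangent_zero M A p})"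

definition tangent_bundle_direct_sum ::
    "'m set \<Rightarrow> ('m, 'e::convenient_vector_space) chart set
       \<Rightarrow> ('m \<Rightarrow> (real \<Rightarrow> 'm) set set) \<Rightarrow> ('m \<Rightarrow> (real \<Rightarrow> 'm) set set) \<Rightarrow> bool" where
  "tangent_bundle_direct_sum M A H V \<longleftrightarrow>
     (\<forall>p\<in>M. tangent_space M A p = {tangent_add M A p h v |h v. h \<in> H p \<and> v \<in> V p} \<and>
             H p \<inter> V p = {tangent_zero M A p})"

definition weakly_nondegenerate_on ::
    "'m set \<Rightarrow> ('m, 'e::convenient_vector_space) chart set \<Rightarrow> 'm form2
       \<Rightarrow> ('m \<Rightarrow> (real \<Rightarrow> 'm) set set) \<Rightarrow> bool" where
  "weakly_nondegenerate_on M A \<omega> H \<longleftrightarrow>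
     (\<forall>p\<in>M. {v \<in> H p. \<forall>w\<in>H p. \<omega> p v w = 0} = {tangent_zero M A p})"

section \<open>The map \<open>\<flat>\<close>\<close>

definition flat_at ::
    "'m set \<Rightarrow> ('m, 'e::convenient_vector_space) chart set \<Rightarrow> 'm form1 \<Rightarrow> 'm form2 \<Rightarrow> 'm
       \<Rightarrow> (real \<Rightarrow> 'm) set \<Rightarrow> (real \<Rightarrow> 'm) set \<Rightarrow> real" where
  "flat_at M A \<theta> \<omega> p v = (\<lambda>w\<in>tangent_space M A p. \<omega> p v w + \<theta> p v * \<theta> p w)"

definition flat ::
    "'m set \<Rightarrow> ('m, 'e::convenient_vector_space) chart set \<Rightarrow> 'm form1 \<Rightarrow> 'm form2
       \<Rightarrow> 'm vfield \<Rightarrow> 'm form1" where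
  "flat M A \<theta> \<omega> X = (\<lambda>p\<in>M. flat_at M A \<theta> \<omega> p (X p))"

definition smooth_module_hom ::
    "'m set \<Rightarrow> ('m, 'e::convenient_vector_space) chart set \<Rightarrow> ('m vfield \<Rightarrow> 'm form1) \<Rightarrow> bool" where
  "smooth_module_hom M A F \<longleftrightarrow>
     F \<in> vector_fields M A \<rightarrow> one_forms M A \<and>
     (\<forall>X\<in>vector_fields M A. \<forall>Y\<in>vector_fields M A.
        F (\<lambda>p\<in>M. tangent_add M A p (X p) (Y p)) =
          (\<lambda>p\<in>M. \<lambda>w\<in>tangent_space M A p. F X p w + F Y p w)) \<and>
     (\<forall>f\<in>smooth_functions M A. \<forall>X\<in>vector_fields M A.
        F (\<lambda>p\<in>M. tangent_scale M A p (f p) (X p)) =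
          (\<lambda>p\<in>M. \<lambda>w\<in>tangent_space M A p. f p * F X p w))"

text \<open>
  Injectivity of \<open>\<flat>\<close> as a tensor: on global sections and on each fibre.  Injectivity on global
  sections alone would not imply the other two conditions of the theorem: on the real line take
  \<open>\<theta> = x dx\<close> and \<open>\<omega> = 0\<close>.  If \<open>x\<^sup>2 X(x) = 0\<close> for all \<open>x\<close> then \<open>X = 0\<close> by continuity, but at the
  origin both kernels are the whole tangent space.
\<close>

definition flat_injective ::
    "'m set \<Rightarrow> ('m, 'e::convenient_vector_space) chart set \<Rightarrow> 'm form1 \<Rightarrow> 'm form2 \<Rightarrow> bool" where
  "flat_injective M A \<theta> \<omega> \<longleftrightarrow>
     inj_on (flat M A \<theta> \<omega>) (vector_fields M A) \<and>
     (\<forall>p\<in>M. inj_on (flat_at M A \<theta> \<omega> p) (tangent_space M A p))"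

end

theory Submission
  imports Defs "HOL-Library.Function_Algebras"
begin

text \<open>
  The equivalences hold fibre by fibre and are linear algebra.  If \<open>\<omega>|\<^sub>\<H>\<close> is non-degenerate, a
  non-zero \<open>\<xi> \<in> ker \<omega>\<close> lies outside \<open>\<H>\<close>, so \<open>\<xi>\<close> spans a complement of the hyperplane \<open>\<H> = ker \<theta>\<close>;
  evaluating \<open>\<flat>(v) = 0\<close> at \<open>\<xi>\<close> gives \<open>\<theta>(v) = 0\<close>, hence \<open>\<omega>(v,\<cdot>) = 0\<close> and \<open>v = 0\<close>.  Analysis enters
  in two places only: each vector of the model space is the velocity of a smooth curve in \<open>M\<close>,
  and \<open>\<flat>(X)\<close> is smooth.  The latter is the Leibniz rule for inserting a smooth curve of vectors into
  a smooth curve of forms; it holds uniformly on bounded sets because curve segments are compact,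
  hence bounded.  Smoothness itself is proved coinductively: a set of curves, each of which has a
  derivative that is a sum of two members of the set, consists of smooth curves.
\<close>

section \<open>Calculus of curves in topological vector spaces\<close>

text \<open>On a space that is not normable, evaluating a continuous form at a vector is not jointly
  continuous in the form and the vector. So the smoothness of \<open>\<theta> p (X p)\<close> and of
  the insertion of \<open>X p\<close> into \<open>\<omega> p\<close> cannot come from composing with
  a continuous bilinear map. Each Leibniz rule is instead proved on difference quotients along a
  curve: near the parameter in question the vector curve stays in one bounded set, and there the
  quotients of the forms converge uniformly. Iterating such rules directly would call for binomial
  and Faa di Bruno formulas. The coinduction replaces them by a single differentiation step on a
  suitably large family, so that choosing the family is the only real work in each smoothness
  proof.\<close>

lemma tvs_tendsto_scaleR:
  fixes g :: "'b \<Rightarrow> 'a::real_topological_vector_space"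
  assumes "(f \<longlongrightarrow> r) F" and "(g \<longlongrightarrow> a) F"
  shows "((\<lambda>x. f x *\<^sub>R g x) \<longlongrightarrow> r *\<^sub>R a) F"
  using filterlim_compose[OF tendsto_scaleR_Pair filterlim_Pair[OF assms]] by simp

lemma has_curve_derivative_real:
  "has_curve_derivative (g :: real \<Rightarrow> real) d t \<longleftrightarrow> (g has_real_derivative d) (at t)"
  unfolding has_curve_derivative_def DERIV_def by (simp add: divide_inverse mult.commute)

lemma has_curve_derivative_unique:
  fixes c :: "real \<Rightarrow> 'a::locally_convex_space"
  assumes "has_curve_derivative c d t" and "has_curve_derivative c d' t"
  shows "d = d'"
  using assms unfolding has_curve_derivative_def by (rule tendsto_unique[OF trivial_limit_at])

lemma has_curve_derivative_cong_open:
  fixes c :: "real \<Rightarrow> 'a::real_topological_vector_space"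
  assumes "has_curve_derivative c d t" and "open J" and "t \<in> J"
    and "\<And>s. s \<in> J \<Longrightarrow> c s = e s"
  shows "has_curve_derivative e d t"
proof -
  have "open ((\<lambda>h. t + h) -` J)"
    using assms(2) by (intro continuous_open_vimage continuous_intros)
  then have "\<forall>\<^sub>F h in at 0. h \<in> (\<lambda>h. t + h) -` J"
    using assms(3) by (intro eventually_at_in_open') auto
  then have "\<forall>\<^sub>F h in at 0. (c (t + h) - c t) /\<^sub>R h = (e (t + h) - e t) /\<^sub>R h"
    by eventually_elim (use assms(3,4) in auto)
  from tendsto_cong[OF this] assms(1) show ?thesis
    unfolding has_curve_derivative_def by blast
qed

lemma has_curve_derivative_imp_isCont:
  fixes c :: "real \<Rightarrow> 'a::real_topological_vector_space"
  assumes "has_curve_derivative c d t"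
  shows "isCont c t"
proof -
  have "((\<lambda>h. h *\<^sub>R ((c (t + h) - c t) /\<^sub>R h)) \<longlongrightarrow> 0 *\<^sub>R d) (at 0)"
    using assms unfolding has_curve_derivative_def
    by (intro tvs_tendsto_scaleR tendsto_ident_at)
  then have "((\<lambda>h. h *\<^sub>R ((c (t + h) - c t) /\<^sub>R h) + c t) \<longlongrightarrow> 0 *\<^sub>R d + c t) (at 0)"
    by (intro tendsto_intros)
  moreover have "\<forall>\<^sub>F h in at 0. h *\<^sub>R ((c (t + h) - c t) /\<^sub>R h) + c t = c (t + h)"
    by (auto simp: eventually_at_filter)
  ultimately have "((\<lambda>h. c (t + h)) \<longlongrightarrow> c t) (at 0)"
    using tendsto_cong by fastforce
  then show ?thesis
    by (simp add: isCont_def LIM_offset_zero_iff)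
qed

lemma has_curve_derivative_const:
  "has_curve_derivative (\<lambda>s. a :: 'a::real_topological_vector_space) 0 t"
  by (simp add: has_curve_derivative_def)

lemma has_curve_derivative_add:
  fixes c e :: "real \<Rightarrow> 'a::real_topological_vector_space"
  assumes "has_curve_derivative c c' t" and "has_curve_derivative e e' t"
  shows "has_curve_derivative (\<lambda>s. c s + e s) (c' + e') t"
  using tendsto_add[OF assms[unfolded has_curve_derivative_def]]
  by (simp add: has_curve_derivative_def algebra_simps)

lemma has_curve_derivative_scaleR:
  fixes c :: "real \<Rightarrow> 'a::real_topological_vector_space"
  assumes g: "has_curve_derivative g g' t" and c: "has_curve_derivative c c' t"
  shows "has_curve_derivative (\<lambda>s. g s *\<^sub>R c s) (g' *\<^sub>R c t + g t *\<^sub>R c') t"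
proof -
  have "((\<lambda>h. g (t + h)) \<longlongrightarrow> g t) (at 0)"
    using has_curve_derivative_imp_isCont[OF g] by (simp add: isCont_def LIM_offset_zero_iff)
  then have "((\<lambda>h. ((g (t + h) - g t) /\<^sub>R h) *\<^sub>R c t + g (t + h) *\<^sub>R ((c (t + h) - c t) /\<^sub>R h))
      \<longlongrightarrow> g' *\<^sub>R c t + g t *\<^sub>R c') (at 0)"
    using g c unfolding has_curve_derivative_def
    by (intro tendsto_add tvs_tendsto_scaleR tendsto_const)
  moreover have "((g (t + h) - g t) /\<^sub>R h) *\<^sub>R c t + g (t + h) *\<^sub>R ((c (t + h) - c t) /\<^sub>R h)
      = (g (t + h) *\<^sub>R c (t + h) - g t *\<^sub>R c t) /\<^sub>R h" for h
    by (simp add: algebra_simps)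
  ultimately show ?thesis
    by (simp add: has_curve_derivative_def)
qed

lemma has_curve_derivative_compose:
  fixes c :: "real \<Rightarrow> 'a::real_topological_vector_space"
  assumes c: "has_curve_derivative c c' (g t)" and g: "has_curve_derivative g g' t"
  shows "has_curve_derivative (\<lambda>s. c (g s)) (g' *\<^sub>R c') t"
proof -
  \<comment> \<open>The increment of \<open>g\<close> may vanish for \<open>h\<close> arbitrarily
    close to 0. Filling in \<open>c'\<close> at 0 makes \<open>q\<close> continuous there and the
    factorisation below valid for every \<open>h\<close>.\<close>
  define q where "q k = (if k = 0 then c' else (c (g t + k) - c (g t)) /\<^sub>R k)" for k
  have "(q \<longlongrightarrow> c') (at 0)"
    using c unfolding has_curve_derivative_def
    by (rule Lim_transform_eventually) (auto simp: q_def eventually_at_filter)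
  then have "isCont q 0"
    by (simp add: isCont_def q_def)
  moreover have "((\<lambda>h. g (t + h) - g t) \<longlongrightarrow> 0) (at 0)"
    using has_curve_derivative_imp_isCont[OF g]
    by (simp add: isCont_def LIM_offset_zero_iff LIM_zero)
  ultimately have "((\<lambda>h. q (g (t + h) - g t)) \<longlongrightarrow> q 0) (at 0)"
    by (rule isCont_tendsto_compose)
  then have "((\<lambda>h. ((g (t + h) - g t) /\<^sub>R h) *\<^sub>R q (g (t + h) - g t)) \<longlongrightarrow> g' *\<^sub>R c') (at 0)"
    using g unfolding has_curve_derivative_def q_def by (intro tvs_tendsto_scaleR) auto
  moreover have "((g (t + h) - g t) /\<^sub>R h) *\<^sub>R q (g (t + h) - g t)
      = (c (g (t + h)) - c (g t)) /\<^sub>R h" for h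
    by (auto simp: q_def)
  ultimately show ?thesis
    by (simp add: has_curve_derivative_def)
qed

section \<open>Smoothness by coinduction\<close>

text \<open>Differentiating a product leaves the family of products but not its additive closure. A
  derivative with a single term is brought into this form by a zero member of the family.\<close>

inductive_set sum_closure :: "'a::plus set \<Rightarrow> 'a set" for P where
  base: "s \<in> P \<Longrightarrow> s \<in> sum_closure P"
| add: "a \<in> sum_closure P \<Longrightarrow> b \<in> sum_closure P \<Longrightarrow> a + b \<in> sum_closure P"

text \<open>The relation \<open>deriv\<close> is kept abstract so that one argument serves curves of
  vectors as well as curves of forms. Additivity carries the existence of derivatives from the
  family to all finite sums; choosing one derivative for each sum and iterating the choice gives the
  whole sequence.\<close>

lemma derivation_sequence:
  fixes F :: "'i \<Rightarrow> 'a::plus" and deriv :: "'a \<Rightarrow> 'a \<Rightarrow> bool"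
  assumes add: "\<And>a a' b b'. deriv a a' \<Longrightarrow> deriv b b' \<Longrightarrow> deriv (a + b) (a' + b')"
    and step: "\<And>i. i \<in> I \<Longrightarrow> l i \<in> I \<and> r i \<in> I \<and> deriv (F i) (F (l i) + F (r i))"
    and "i \<in> I"
  shows "\<exists>D. D 0 = F i \<and> (\<forall>n::nat. D n \<in> sum_closure (F ` I) \<and> deriv (D n) (D (Suc n)))"
proof -
  have "\<exists>s'\<in>sum_closure (F ` I). deriv s s'" if "s \<in> sum_closure (F ` I)" for s
    using that
  proof induction
    case (base s)
    then obtain j where j: "j \<in> I" "s = F j" by blast
    have "F (l j) + F (r j) \<in> sum_closure (F ` I)"
      using step[OF j(1)] by (intro sum_closure.intros imageI) auto
    then show ?case using step[OF j(1)] j(2) by blast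
  next
    case (add a b)
    then show ?case using assms(1) sum_closure.add by meson
  qed
  then obtain f where f: "f s \<in> sum_closure (F ` I)" "deriv s (f s)" if "s \<in> sum_closure (F ` I)" for s
    by metis
  define D where "D n = (f ^^ n) (F i)" for n
  have "D n \<in> sum_closure (F ` I)" for n
    by (induction n) (use f \<open>i \<in> I\<close> in \<open>auto simp: D_def intro: sum_closure.base\<close>)
  then show ?thesis
    using f(2) by (intro exI[of _ D]) (auto simp: D_def)
qed

lemma smooth_curve_on_coinduct:
  fixes F :: "'i \<Rightarrow> real \<Rightarrow> 'a::real_topological_vector_space"
  assumes "i \<in> I" and "\<And>i. i \<in> I \<Longrightarrow> l i \<in> I" and "\<And>i. i \<in> I \<Longrightarrow> r i \<in> I"
    and "\<And>i t. i \<in> I \<Longrightarrow> t \<in> J \<Longrightarrow> has_curve_derivative (F i) (F (l i) t + F (r i) t) t"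
  shows "smooth_curve_on J (F i)"
proof -
  have "\<exists>D. D 0 = F i \<and> (\<forall>n::nat. D n \<in> sum_closure (F ` I) \<and>
      (\<forall>t\<in>J. has_curve_derivative (D n) (D (Suc n) t) t))"
    using assms
    by (intro derivation_sequence[where deriv = "\<lambda>s s'. \<forall>t\<in>J. has_curve_derivative s (s' t) t"
          and l = l and r = r])
      (auto simp: plus_fun_def intro!: has_curve_derivative_add)
  then show ?thesis
    unfolding smooth_curve_on_def by metis
qed

text \<open>The definition of smoothness lets \<open>D 0\<close> differ from \<open>c\<close>
  outside \<open>J\<close>. Since derivatives are local and \<open>J\<close> is open,
  \<open>c\<close> itself may be put in its place.\<close>

lemma smooth_curve_on_derivatives:
  fixes c :: "real \<Rightarrow> 'a::real_topological_vector_space"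
  assumes "smooth_curve_on J c" and "open J"
  obtains D where "D 0 = c" and "\<And>n t. t \<in> J \<Longrightarrow> has_curve_derivative (D n) (D (Suc n) t) t"
proof -
  obtain D where D: "\<forall>t\<in>J. D 0 t = c t" "\<And>n t. t \<in> J \<Longrightarrow> has_curve_derivative (D n) (D (Suc n) t) t"
    using assms(1) unfolding smooth_curve_on_def by blast
  have "has_curve_derivative ((D(0 := c)) n) ((D(0 := c)) (Suc n) t) t" if "t \<in> J" for n t
    using D(1) has_curve_derivative_cong_open[OF D(2)[OF that, of 0] assms(2) that, of c]
      D(2)[OF that, of n] by (cases n) auto
  then show thesis
    using that[of "D(0 := c)"] by simp
qed

lemma smooth_curve_on_from_derivative:
  fixes c :: "real \<Rightarrow> 'a::real_topological_vector_space"
  assumes "\<And>t. t \<in> J \<Longrightarrow> has_curve_derivative c (c' t) t" and "smooth_curve_on J c'" and "open J"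
  shows "smooth_curve_on J c"
proof -
  obtain D where D: "D 0 = c'" "\<And>n t. t \<in> J \<Longrightarrow> has_curve_derivative (D n) (D (Suc n) t) t"
    using smooth_curve_on_derivatives[OF assms(2,3)] by blast
  define E where "E n = (case n of 0 \<Rightarrow> c | Suc k \<Rightarrow> D k)" for n
  have "has_curve_derivative (E n) (E (Suc n) t) t" if "t \<in> J" for n t
    using assms(1)[OF that] D(1) D(2)[OF that] by (cases n) (auto simp: E_def)
  then show ?thesis
    unfolding smooth_curve_on_def by (intro exI[of _ E]) (auto simp: E_def)
qed

section \<open>Affine curves, products, compositions and two reparametrisations\<close>

lemma smooth_curve_on_affine:
  "smooth_curve_on J (\<lambda>s. a + s *\<^sub>R (b :: 'a::real_topological_vector_space))"
proof -
  let ?F = "\<lambda>i s. fst i + s *\<^sub>R (snd i :: 'a)"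
  have "smooth_curve_on J (?F (a, b))"
  proof (rule smooth_curve_on_coinduct[where F = ?F and I = UNIV and l = "\<lambda>i. (snd i, 0)" and r = "\<lambda>i. 0"])
    fix i :: "'a \<times> 'a" and t
    have "has_curve_derivative (?F i) (0 + (1 *\<^sub>R snd i + t *\<^sub>R 0)) t"
      by (intro has_curve_derivative_add has_curve_derivative_scaleR has_curve_derivative_const)
        (simp add: has_curve_derivative_real)
    then show "has_curve_derivative (?F i) (?F (snd i, 0) t + ?F 0 t) t" by simp
  qed simp_all
  then show ?thesis by simp
qed

lemma smooth_curve_const: "smooth_curve_on J (\<lambda>s. a :: 'a::real_topological_vector_space)"
  using smooth_curve_on_affine[of J a 0] by simp

lemma smooth_curve_on_scaleR:
  fixes c :: "real \<Rightarrow> 'a::real_topological_vector_space"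
  assumes "smooth_curve_on J g" and "smooth_curve_on J c" and "open J"
  shows "smooth_curve_on J (\<lambda>s. g s *\<^sub>R c s)"
proof -
  obtain G where G: "G 0 = g" "\<And>n t. t \<in> J \<Longrightarrow> has_curve_derivative (G n) (G (Suc n) t) t"
    using smooth_curve_on_derivatives[OF assms(1,3)] by blast
  obtain C where C: "C 0 = c" "\<And>n t. t \<in> J \<Longrightarrow> has_curve_derivative (C n) (C (Suc n) t) t"
    using smooth_curve_on_derivatives[OF assms(2,3)] by blast
  let ?F = "\<lambda>i s. G (fst i) s *\<^sub>R C (snd i) s"
  have "smooth_curve_on J (?F (0, 0))"
  proof (rule smooth_curve_on_coinduct[where F = ?F and I = UNIV
        and l = "\<lambda>i. (Suc (fst i), snd i)" and r = "\<lambda>i. (fst i, Suc (snd i))"])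
    show "has_curve_derivative (?F i) (?F (Suc (fst i), snd i) t + ?F (fst i, Suc (snd i)) t) t"
      if "t \<in> J" for i t
      unfolding fst_conv snd_conv using that by (intro has_curve_derivative_scaleR G C)
  qed simp_all
  then show ?thesis by (simp add: G C)
qed

lemma smooth_curve_on_compose:
  fixes c :: "real \<Rightarrow> 'a::real_topological_vector_space"
  assumes "smooth_curve_on K c" and "open K"
    and "smooth_curve_on J g" and "open J" and "g ` J \<subseteq> K"
  shows "smooth_curve_on J (\<lambda>s. c (g s))"
proof -
  obtain C where C: "C 0 = c" "\<And>n t. t \<in> K \<Longrightarrow> has_curve_derivative (C n) (C (Suc n) t) t"
    using smooth_curve_on_derivatives[OF assms(1,2)] by blast
  have "\<exists>d. smooth_curve_on J d \<and> (\<forall>t\<in>J. has_curve_derivative k (d t) t)"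
    if k: "smooth_curve_on J k" for k :: "real \<Rightarrow> real"
  proof -
    obtain D where D: "D 0 = k" "\<And>n t. t \<in> J \<Longrightarrow> has_curve_derivative (D n) (D (Suc n) t) t"
      using smooth_curve_on_derivatives[OF k assms(4)] by blast
    then have "smooth_curve_on J (D 1)"
      unfolding smooth_curve_on_def by (intro exI[of _ "\<lambda>n. D (Suc n)"]) simp
    then show ?thesis
      using D(1) D(2)[of _ 0] by (intro exI[of _ "D 1"]) simp
  qed
  \<comment> \<open>Coinduction wants the two successors as functions of the index, and the index
    contains \<open>k\<close>; hence a derivative is chosen for all smooth \<open>k\<close> at
    once.\<close>
  then have "\<exists>d. \<forall>k :: real \<Rightarrow> real. smooth_curve_on J k \<longrightarrow>
      smooth_curve_on J (d k) \<and> (\<forall>t\<in>J. has_curve_derivative k (d k t) t)"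
    by metis
  then obtain d where d: "\<And>k :: real \<Rightarrow> real. smooth_curve_on J k \<Longrightarrow> smooth_curve_on J (d k)"
    "\<And>(k :: real \<Rightarrow> real) t. smooth_curve_on J k \<Longrightarrow> t \<in> J \<Longrightarrow> has_curve_derivative k (d k t) t"
    by blast
  let ?F = "\<lambda>i s. fst i s *\<^sub>R C (snd i) (g s)"
  let ?l = "\<lambda>i. (d (fst i), snd i)" and ?r = "\<lambda>i. (\<lambda>s. fst i s *\<^sub>R d g s, Suc (snd i))"
  have "smooth_curve_on J (?F (\<lambda>s. 1, 0))"
  proof (rule smooth_curve_on_coinduct[where F = ?F and I = "{k. smooth_curve_on J k} \<times> UNIV"
        and l = ?l and r = ?r])
    fix i :: "(real \<Rightarrow> real) \<times> nat" and t
    assume "i \<in> {k. smooth_curve_on J k} \<times> UNIV" and t: "t \<in> J"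
    then have "has_curve_derivative (?F i)
        (d (fst i) t *\<^sub>R C (snd i) (g t) + fst i t *\<^sub>R (d g t *\<^sub>R C (Suc (snd i)) (g t))) t"
      using assms(3,5) by (intro has_curve_derivative_scaleR has_curve_derivative_compose d C) auto
    then show "has_curve_derivative (?F i) (?F (?l i) t + ?F (?r i) t) t" by simp
  next
    fix i :: "(real \<Rightarrow> real) \<times> nat"
    assume "i \<in> {k. smooth_curve_on J k} \<times> UNIV"
    then have i: "smooth_curve_on J (fst i)" by auto
    have "smooth_curve_on J (\<lambda>s. fst i s *\<^sub>R d g s)"
      using i d(1)[OF assms(3)] assms(4) by (rule smooth_curve_on_scaleR)
    then show "?r i \<in> {k. smooth_curve_on J k} \<times> UNIV" by simp
    show "?l i \<in> {k. smooth_curve_on J k} \<times> UNIV" using d(1)[OF i] by simp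
  qed (simp add: smooth_curve_const)
  then show ?thesis by (simp add: C(1))
qed

text \<open>With \<open>q\<close> the inverse of \<open>1 + s\<^sup>2\<close>, the products of
  polynomials and powers of \<open>q\<close> are closed under differentiation: the n-th power of
  \<open>q\<close> has derivative \<open>- 2 * n * s\<close> times its power of exponent
  \<open>n + 1\<close>.\<close>

lemma smooth_curve_arctan: "smooth_curve arctan"
proof (rule smooth_curve_on_from_derivative)
  show "has_curve_derivative arctan (inverse (1 + t\<^sup>2)) t" for t
    by (simp add: has_curve_derivative_real DERIV_arctan)
  let ?F = "\<lambda>i s. poly (fst i) s * inverse (1 + s\<^sup>2) ^ snd i :: real"
  let ?l = "\<lambda>i. (pderiv (fst i), snd i)"
    and ?r = "\<lambda>i. (fst i * [:0, - 2 * real (snd i):], Suc (snd i))"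
  have "smooth_curve (?F (1, 1))"
  proof (rule smooth_curve_on_coinduct[where F = ?F and I = UNIV and l = ?l and r = ?r])
    fix i :: "real poly \<times> nat" and t :: real
    have "1 + t\<^sup>2 \<noteq> 0" by (metis add_pos_nonneg less_numeral_extra(1,3) zero_le_power2)
    then have "((\<lambda>s. inverse (1 + s\<^sup>2)) has_real_derivative - (2 * t) * inverse (1 + t\<^sup>2) ^ 2) (at t)"
      by (auto intro!: derivative_eq_intros simp: power2_eq_square)
    from DERIV_mult[OF poly_DERIV DERIV_power[OF this, of "snd i"]]
    show "has_curve_derivative (?F i) (?F (?l i) t + ?F (?r i) t) t"
      unfolding has_curve_derivative_real
      by (rule DERIV_cong) (cases "snd i"; simp add: algebra_simps power2_eq_square)
  qed simp_all
  then show "smooth_curve (\<lambda>t::real. inverse (1 + t\<^sup>2))" by simp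
qed simp

text \<open>Since tan' = 1 + tan * tan, polynomials in tan are closed under differentiation;
  \<open>[:1, 0, 1:]\<close> is this factor, and the second summand is the zero polynomial.\<close>

lemma smooth_curve_on_tan: "smooth_curve_on {- (pi / 2)<..<pi / 2} tan"
proof -
  let ?F = "\<lambda>p s. poly p (tan s) :: real" and ?l = "\<lambda>p. pderiv p * [:1, 0, 1:]"
  have "smooth_curve_on {- (pi / 2)<..<pi / 2} (?F [:0, 1:])"
  proof (rule smooth_curve_on_coinduct[where F = ?F and I = UNIV and l = ?l and r = "\<lambda>p. 0"])
    fix p :: "real poly" and t :: real assume t: "t \<in> {- (pi / 2)<..<pi / 2}"
    have cos: "cos t \<noteq> 0" using cos_gt_zero_pi[of t] t by auto
    have "(?F p has_real_derivative poly (pderiv p) (tan t) * inverse ((cos t)\<^sup>2)) (at t)"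
      by (rule DERIV_chain'[OF DERIV_tan[OF cos] poly_DERIV])
    moreover have "inverse ((cos t)\<^sup>2) = 1 + tan t * tan t"
      using tan_sec[OF cos] by (simp add: power2_eq_square)
    ultimately show "has_curve_derivative (?F p) (?F (?l p) t + ?F 0 t) t"
      by (simp add: has_curve_derivative_real algebra_simps)
  qed simp_all
  then show ?thesis by simp
qed

section \<open>Curves in open subsets of the model space\<close>

text \<open>
  The smoothness of a map on an open set is only tested on curves defined on all of \<open>\<real>\<close>.  The
  diffeomorphism \<open>arctan\<close> from \<open>\<real>\<close> onto a bounded interval shrinks a curve into the open set,
  and \<open>tan\<close> undoes this.
\<close>

lemma smooth_curve_shrink:
  fixes e :: "real \<Rightarrow> 'e::convenient_vector_space"
  assumes "cinf_open W" and "smooth_curve e" and "e t \<in> W"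
  obtains \<epsilon> where "\<epsilon> > 0" and "smooth_curve (\<lambda>s. e (t + \<epsilon> * arctan s))"
    and "\<And>s. \<bar>s - t\<bar> < 2 * \<epsilon> \<Longrightarrow> e s \<in> W"
proof -
  have "open (e -` W)"
    using assms unfolding cinf_open_def by blast
  then obtain \<delta> where \<delta>: "\<delta> > 0" "ball t \<delta> \<subseteq> e -` W"
    using assms(3) by (meson openE vimageI)
  have "smooth_curve (\<lambda>s. t + arctan s *\<^sub>R (\<delta> / 2))"
    by (rule smooth_curve_on_compose[OF smooth_curve_on_affine open_UNIV smooth_curve_arctan]) auto
  then have "smooth_curve (\<lambda>s. e (t + arctan s *\<^sub>R (\<delta> / 2)))"
    by (rule smooth_curve_on_compose[OF assms(2) open_UNIV]) auto
  then show thesis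
    using \<delta> by (intro that[of "\<delta> / 2"]) (auto simp: subset_eq dist_real_def mult.commute)
qed

lemma abs_mult_arctan_less:
  assumes "\<epsilon> > 0"
  shows "\<bar>\<epsilon> * arctan s\<bar> < 2 * \<epsilon>"
proof -
  have "\<bar>arctan s\<bar> < 2"
    using arctan_bounded[of s] pi_less_4 by linarith
  then show ?thesis
    using assms by (simp add: abs_mult)
qed

text \<open>The shrunk curve lies entirely in \<open>W\<close>, so its image \<open>?g\<close> under
  \<open>f\<close> is smooth on the whole line. Near \<open>t\<close> the original composite is
  recovered as \<open>?g\<close> after tan after \<open>?h\<close>.\<close>

lemma smooth_map_on_compose_curve_local:
  fixes e :: "real \<Rightarrow> 'e::convenient_vector_space"
    and f :: "'e \<Rightarrow> 'f::real_topological_vector_space"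
  assumes "smooth_map_on W f" and "cinf_open W" and "smooth_curve e" and "e t \<in> W"
  obtains J where "open J" and "t \<in> J" and "e ` J \<subseteq> W" and "smooth_curve_on J (f \<circ> e)"
proof -
  obtain \<epsilon> where \<epsilon>: "\<epsilon> > 0" "smooth_curve (\<lambda>s. e (t + \<epsilon> * arctan s))"
    and W: "\<And>s. \<bar>s - t\<bar> < 2 * \<epsilon> \<Longrightarrow> e s \<in> W"
    using smooth_curve_shrink[OF assms(2-4)] by blast
  \<comment> \<open>\<open>?h s\<close> is (s - t) / \<epsilon> in the shape of an affine
    curve.\<close>
  let ?g = "\<lambda>s. f (e (t + \<epsilon> * arctan s))" and ?h = "\<lambda>s. - (t / \<epsilon>) + s *\<^sub>R (1 / \<epsilon>)"
  \<comment> \<open>With radius \<open>\<epsilon>\<close>, the values of \<open>?h\<close> stay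
    below 1 in absolute value, hence inside the domain of tan on which arctan inverts it.\<close>
  define J where "J = {t - \<epsilon><..<t + \<epsilon>}"
  have "range (\<lambda>s. e (t + \<epsilon> * arctan s)) \<subseteq> W"
    using W abs_mult_arctan_less[OF \<epsilon>(1)] by auto
  then have g: "smooth_curve ?g"
    using assms(1) \<epsilon>(2) unfolding smooth_map_on_def comp_def by blast
  have h: "?h ` J \<subseteq> {- (pi / 2)<..<pi / 2}"
  proof -
    have "?h s \<in> {- (pi / 2)<..<pi / 2}" if "s \<in> J" for s
    proof -
      have "?h s = (s - t) / \<epsilon>" by (simp add: diff_divide_distrib)
      then have "\<bar>?h s\<bar> < 1" using that \<epsilon>(1) by (auto simp: J_def abs_less_iff field_simps)
      then show ?thesis using pi_gt3 unfolding greaterThanLessThan_iff by linarith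
    qed
    then show ?thesis by blast
  qed
  have "smooth_curve_on J (\<lambda>s. ?g (tan (?h s)))"
    by (rule smooth_curve_on_compose[OF g _ smooth_curve_on_compose[OF smooth_curve_on_tan _
            smooth_curve_on_affine _ h]])
      (auto simp: J_def)
  moreover have "?g (tan (?h s)) = (f \<circ> e) s" if "s \<in> J" for s
  proof -
    have "arctan (tan (?h s)) = ?h s"
      using h that by (intro arctan_tan) auto
    moreover have "t + \<epsilon> * ?h s = s"
      using \<epsilon>(1) by (simp add: field_simps)
    ultimately show ?thesis
      by simp
  qed
  ultimately have "smooth_curve_on J (f \<circ> e)"
    unfolding smooth_curve_on_def by metis
  with \<epsilon>(1) W show thesis
    by (intro that[of J]) (auto simp: J_def)
qed

text \<open>The straight line through \<open>a\<close> in direction \<open>y\<close> may leave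
  \<open>W\<close>, so its parameter is bent by the bounded function \<epsilon> * arctan (s /
  \<epsilon>), which fixes 0.\<close>

lemma smooth_curve_with_velocity:
  fixes a y :: "'e::convenient_vector_space"
  assumes "cinf_open W" and "a \<in> W"
  obtains e where "smooth_curve e" and "range e \<subseteq> W" and "e 0 = a"
    and "has_curve_derivative e y 0"
proof -
  have "a + 0 *\<^sub>R y \<in> W" using assms(2) by simp
  then obtain \<epsilon> where \<epsilon>: "\<epsilon> > 0" "smooth_curve (\<lambda>s. a + (0 + \<epsilon> * arctan s) *\<^sub>R y)"
    and W: "\<And>s. \<bar>s - 0\<bar> < 2 * \<epsilon> \<Longrightarrow> a + s *\<^sub>R y \<in> W"
    by (rule smooth_curve_shrink[OF assms(1) smooth_curve_on_affine[of UNIV a y]]) (rule that)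
  \<comment> \<open>The inner factor 1 / \<epsilon> cancels the outer \<epsilon> in the derivative
    at 0, so that the velocity is exactly \<open>y\<close>.\<close>
  let ?g = "\<lambda>s. 0 + \<epsilon> * arctan ((1 / \<epsilon>) * s)"
  let ?e = "\<lambda>s. a + ?g s *\<^sub>R y"
  have "smooth_curve (\<lambda>s. 0 + s *\<^sub>R (1 / \<epsilon>))"
    by (rule smooth_curve_on_affine)
  then have "smooth_curve ?e"
    using smooth_curve_on_compose[OF \<epsilon>(2) open_UNIV, of UNIV "\<lambda>s. 0 + s *\<^sub>R (1 / \<epsilon>)"] by simp
  moreover have "range ?e \<subseteq> W"
    using W abs_mult_arctan_less[OF \<epsilon>(1)] by auto
  moreover have "has_curve_derivative ?e (0 + (1 *\<^sub>R y + ?g 0 *\<^sub>R 0)) 0"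
  proof (intro has_curve_derivative_add has_curve_derivative_scaleR has_curve_derivative_const)
    show "has_curve_derivative ?g 1 0"
      using \<epsilon>(1) unfolding has_curve_derivative_real by (auto intro!: derivative_eq_intros)
  qed
  ultimately show thesis
    using that[of ?e] by simp
qed

lemma smooth_form_curve_member: "smooth_form_curve L \<B> a \<Longrightarrow> a t \<in> L"
  unfolding smooth_form_curve_def by metis

section \<open>Tangent vectors in coordinates\<close>

locale convenient_mfd =
  fixes M :: "'m set" and A :: "('m, 'e::convenient_vector_space) chart set"
  assumes manifold: "convenient_manifold M A"
begin

text \<open>In the chart that defines the vector space operations of the fibre, \<open>tv p\<close>
  is a linear isomorphism from the model space onto the tangent space; all fibrewise statements are
  pulled back along it.\<close>

abbreviation tv :: "'m \<Rightarrow> 'e \<Rightarrow> (real \<Rightarrow> 'm) set" where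
  "tv p \<equiv> tangent_vector M A (snd (chart_at A p)) p"

lemma chart_inj_on: "inj_on u U"
  and chart_cinf_open: "cinf_open (u ` U)"
  and chart_subset: "U \<subseteq> M"
  if "(U, u) \<in> A"
proof -
  have M: "(\<Union>(U, u)\<in>A. U) = M"
    using manifold unfolding convenient_manifold_def by (elim conjE)
  have "\<forall>(U, u)\<in>A. inj_on u U \<and> cinf_open (u ` U)"
    using manifold unfolding convenient_manifold_def by (elim conjE)
  from bspec[OF this that] show "inj_on u U" "cinf_open (u ` U)"
    by auto
  show "U \<subseteq> M"
    unfolding M[symmetric] using that by auto
qed

lemma transition_cinf_open: "cinf_open (u ` (U \<inter> V))"
  and transition_smooth: "smooth_map_on (u ` (U \<inter> V)) (v \<circ> inv_into U u)"
  if "(U, u) \<in> A" and "(V, v) \<in> A"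
proof -
  have "\<forall>(U, u)\<in>A. \<forall>(V, v)\<in>A.
      cinf_open (u ` (U \<inter> V)) \<and> smooth_map_on (u ` (U \<inter> V)) (v \<circ> inv_into U u)"
    using manifold unfolding convenient_manifold_def by (elim conjE)
  from bspec[OF bspec[OF this that(1), simplified] that(2)]
  show "cinf_open (u ` (U \<inter> V))" "smooth_map_on (u ` (U \<inter> V)) (v \<circ> inv_into U u)"
    by auto
qed

lemma chart_at:
  assumes "p \<in> M"
  obtains U u where "chart_at A p = (U, u)" and "(U, u) \<in> A" and "p \<in> U"
proof -
  have "\<exists>C. C \<in> A \<and> p \<in> fst C"
    using assms manifold unfolding convenient_manifold_def by auto
  then have "chart_at A p \<in> A \<and> p \<in> fst (chart_at A p)"
    unfolding chart_at_def by (rule someI_ex)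
  then show thesis
    using that by (cases "chart_at A p") auto
qed

text \<open>A curve with the required velocity exists in the image of the chart and is carried back
  by the inverse chart. A smooth curve in the manifold must be smooth in every chart that it meets,
  which is where the transition maps and the local composition result enter.\<close>

lemma curve_with_velocity:
  assumes Uu: "(U, u) \<in> A" and p: "p \<in> U"
  obtains c where "c \<in> curves_at M A p" and "has_curve_derivative (u \<circ> c) y 0"
proof -
  obtain e where e: "smooth_curve e" "range e \<subseteq> u ` U" "e 0 = u p" "has_curve_derivative e y 0"
    using smooth_curve_with_velocity[OF chart_cinf_open[OF Uu], of "u p"] p by blast
  define c where "c = inv_into U u \<circ> e"
  have c: "c t \<in> U" "u (c t) = e t" for t
    using e(2) by (auto simp: c_def inv_into_into f_inv_into_f image_subset_iff subset_eq)
  have "\<exists>J. open J \<and> t \<in> J \<and> c ` J \<subseteq> V \<and> smooth_curve_on J (v \<circ> c)"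
    if Vv: "(V, v) \<in> A" and ct: "c t \<in> V" for t V v
  proof -
    have "e t \<in> u ` (U \<inter> V)" using c[of t] ct by (metis IntI image_eqI)
    then obtain J where J: "open J" "t \<in> J" "e ` J \<subseteq> u ` (U \<inter> V)"
      "smooth_curve_on J ((v \<circ> inv_into U u) \<circ> e)"
      using smooth_map_on_compose_curve_local[OF transition_smooth[OF Uu Vv]
          transition_cinf_open[OF Uu Vv] e(1)] by blast
    moreover have "c ` J \<subseteq> V"
      using J(3) chart_inj_on[OF Uu] by (fastforce simp: c_def)
    ultimately show ?thesis
      by (auto simp: c_def comp_assoc)
  qed
  then have "smooth_curve_in M A c"
    using c(1) chart_subset[OF Uu] unfolding smooth_curve_in_def by blast
  moreover have "c 0 = p"
    using e(3) p chart_inj_on[OF Uu] by (simp add: c_def)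
  moreover have "u \<circ> c = e"
    using c(2) by auto
  ultimately show thesis
    using that[of c] e(4) by (simp add: curves_at_def)
qed

lemma tangent_vector_in_tangent_space:
  assumes "(U, u) \<in> A" and "p \<in> U"
  shows "tangent_vector M A u p y \<in> tangent_space M A p"
proof -
  have "\<exists>c. c \<in> curves_at M A p \<and> has_curve_derivative (u \<circ> c) y 0"
    using curve_with_velocity[OF assms] by blast
  from someI_ex[OF this] show ?thesis
    unfolding tangent_vector_def tangent_space_def by (intro quotientI) blast
qed

lemma curves_at_velocity:
  assumes "(U, u) \<in> A" and "p \<in> U" and "c \<in> curves_at M A p"
  obtains y where "has_curve_derivative (u \<circ> c) y 0"
proof -
  obtain J where J: "open J" "0 \<in> J" "smooth_curve_on J (u \<circ> c)"
    using assms unfolding curves_at_def smooth_curve_in_def by force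
  obtain D where "D 0 = u \<circ> c" "\<And>n t. t \<in> J \<Longrightarrow> has_curve_derivative (D n) (D (Suc n) t) t"
    using smooth_curve_on_derivatives[OF J(3,1)] by blast
  then show thesis
    using that J(2) by metis
qed

text \<open>Velocities are unique in a Hausdorff space, so the common velocity hidden in the
  equivalence relation must be \<open>y\<close>.\<close>

lemma same_velocity_class:
  assumes "c \<in> curves_at M A p" and "has_curve_derivative (snd (chart_at A p) \<circ> c) y 0"
  shows "same_velocity M A p `` {c} =
    {e \<in> curves_at M A p. has_curve_derivative (snd (chart_at A p) \<circ> e) y 0}"
proof (intro set_eqI iffI)
  fix e assume "e \<in> same_velocity M A p `` {c}"
  then obtain z where z: "e \<in> curves_at M A p" "has_curve_derivative (snd (chart_at A p) \<circ> c) z 0"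
    "has_curve_derivative (snd (chart_at A p) \<circ> e) z 0"
    unfolding same_velocity_def by blast
  moreover have "y = z"
    using assms(2) z(2) by (rule has_curve_derivative_unique)
  ultimately show "e \<in> {e \<in> curves_at M A p. has_curve_derivative (snd (chart_at A p) \<circ> e) y 0}"
    by simp
qed (use assms in \<open>auto simp: same_velocity_def\<close>)

lemma tv_eq:
  assumes "p \<in> M"
  shows "tv p y = {e \<in> curves_at M A p. has_curve_derivative (snd (chart_at A p) \<circ> e) y 0}"
proof -
  obtain U u where C: "chart_at A p = (U, u)" "(U, u) \<in> A" "p \<in> U"
    using chart_at[OF assms] by blast
  have "\<exists>c. c \<in> curves_at M A p \<and> has_curve_derivative (snd (chart_at A p) \<circ> c) y 0"
    using curve_with_velocity[OF C(2,3)] unfolding C(1) snd_conv by blast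
  from someI_ex[OF this] show ?thesis
    unfolding tangent_vector_def by (intro same_velocity_class) auto
qed

lemma tangent_space_eq_range_tv:
  assumes "p \<in> M"
  shows "tangent_space M A p = range (tv p)"
proof -
  obtain U u where C: "chart_at A p = (U, u)" "(U, u) \<in> A" "p \<in> U"
    using chart_at[OF assms] by blast
  have "v \<in> range (tv p)" if "v \<in> tangent_space M A p" for v
  proof -
    have "\<exists>c\<in>curves_at M A p. v = same_velocity M A p `` {c}"
      using that by (auto simp: tangent_space_def quotient_def)
    then obtain c where c: "c \<in> curves_at M A p" "v = same_velocity M A p `` {c}"
      by blast
    obtain y where "has_curve_derivative (u \<circ> c) y 0"
      by (rule curves_at_velocity[OF C(2,3) c(1)])
    then have y: "has_curve_derivative (snd (chart_at A p) \<circ> c) y 0"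
      by (simp add: C(1))
    have "v = tv p y"
      unfolding tv_eq[OF assms] c(2) by (rule same_velocity_class[OF c(1) y])
    then show ?thesis by blast
  qed
  moreover have "tv p y \<in> tangent_space M A p" for y
    using tangent_vector_in_tangent_space[OF C(2,3)] by (simp add: C(1))
  ultimately show ?thesis by blast
qed

lemma tangent_coord_tv:
  assumes "p \<in> M"
  shows "tangent_coord A p (tv p y) = y"
proof -
  obtain U u where C: "chart_at A p = (U, u)" "(U, u) \<in> A" "p \<in> U"
    using chart_at[OF assms] by blast
  obtain c where "c \<in> curves_at M A p" "has_curve_derivative (u \<circ> c) y 0"
    by (rule curve_with_velocity[OF C(2,3)])
  then have "c \<in> tv p y"
    unfolding tv_eq[OF assms] by (simp add: C(1))
  then show ?thesis
    unfolding tangent_coord_def tv_eq[OF assms]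
    by (intro the_equality) (blast dest: has_curve_derivative_unique)+
qed

lemma tv_eq_iff:
  assumes "p \<in> M"
  shows "tv p y = tv p z \<longleftrightarrow> y = z"
proof
  assume "tv p y = tv p z"
  from arg_cong[OF this, of "tangent_coord A p"] show "y = z"
    unfolding tangent_coord_tv[OF assms] .
qed (rule arg_cong)

lemma tangent_add_tv: "tangent_add M A p (tv p y) (tv p z) = tv p (y + z)"
  and tangent_scale_tv: "tangent_scale M A p r (tv p y) = tv p (r *\<^sub>R y)"
  if "p \<in> M"
  unfolding tangent_add_def tangent_scale_def tangent_coord_tv[OF that] by (rule refl)+

text \<open>Membership in the space of forms is only asserted along smooth curves; the constant
  curve at \<open>u p\<close> yields it at a single point. The same device gives bilinearity and
  alternation below.\<close>

lemma one_form_linear: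
  assumes "\<theta> \<in> one_forms M A" and "p \<in> M"
  shows "linear (\<lambda>y. \<theta> p (tv p y))"
proof -
  obtain U u where C: "chart_at A p = (U, u)" "(U, u) \<in> A" "p \<in> U"
    using chart_at[OF assms(2)] by blast
  let ?\<alpha> = "\<lambda>x y. let p = inv_into U u x in \<theta> p (tangent_vector M A u p y)"
  have "smooth_1_form_on (u ` U) ?\<alpha>"
    using assms(1) C(2) unfolding one_forms_def by blast
  then have "smooth_form_curve continuous_1_forms {B. tvs_bounded B} (?\<alpha> \<circ> (\<lambda>t::real. u p))"
    using C(3) smooth_curve_const[of UNIV "u p"] unfolding smooth_1_form_on_def by blast
  then have "?\<alpha> (u p) \<in> continuous_1_forms"
    using smooth_form_curve_member by fastforce
  then show ?thesis
    using C chart_inj_on[OF C(2)] by (simp add: continuous_1_forms_def)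
qed

lemma two_form_bilinear:
  assumes "\<omega> \<in> two_forms M A" and "p \<in> M"
  shows "bilinear (\<lambda>y z. \<omega> p (tv p y) (tv p z))" and "\<omega> p (tv p y) (tv p y) = 0"
proof -
  obtain U u where C: "chart_at A p = (U, u)" "(U, u) \<in> A" "p \<in> U"
    using chart_at[OF assms(2)] by blast
  let ?\<beta> = "\<lambda>x (y, z). let p = inv_into U u x in
    \<omega> p (tangent_vector M A u p y) (tangent_vector M A u p z)"
  have "smooth_2_form_on (u ` U) ?\<beta>"
    using assms(1) C(2) unfolding two_forms_def by blast
  then have "smooth_form_curve continuous_2_forms {B \<times> C |B C. tvs_bounded B \<and> tvs_bounded C}
      (?\<beta> \<circ> (\<lambda>t::real. u p))"
    using C(3) smooth_curve_const[of UNIV "u p"] unfolding smooth_2_form_on_def by blast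
  then have "?\<beta> (u p) \<in> continuous_2_forms"
    using smooth_form_curve_member by fastforce
  then show "bilinear (\<lambda>y z. \<omega> p (tv p y) (tv p z))" and "\<omega> p (tv p y) (tv p y) = 0"
    using C chart_inj_on[OF C(2)] by (auto simp: continuous_2_forms_def curry_def)
qed

end

section \<open>Linear algebra on a fibre\<close>

text \<open>The fibre at one point in coordinates: \<open>a\<close> stands for \<theta> and
  \<open>b\<close> for \<omega>, with no topology left.\<close>

locale degenerate_pair =
  fixes a :: "'e::real_vector \<Rightarrow> real" and b :: "'e \<Rightarrow> 'e \<Rightarrow> real"
  assumes linear_a: "linear a" and bilinear_b: "bilinear b" and alt: "b y y = 0"
    and degenerate: "{v. \<forall>w. b v w = 0} \<noteq> {0}"
begin

lemmas bilinear_simps = linear_0[OF linear_a] linear_add[OF linear_a] linear_diff[OF linear_a]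
  linear_cmul[OF linear_a]
  bilinear_lzero[OF bilinear_b] bilinear_rzero[OF bilinear_b]
  bilinear_ladd[OF bilinear_b] bilinear_radd[OF bilinear_b]
  bilinear_lsub[OF bilinear_b] bilinear_rsub[OF bilinear_b]
  bilinear_lmul[OF bilinear_b] bilinear_rmul[OF bilinear_b]

lemma skew: "b y z = - b z y"
proof -
  have "b (y + z) (y + z) = b y y + b y z + (b z y + b z z)"
    by (simp add: bilinear_simps)
  then show ?thesis
    using alt[of "y + z"] alt[of y] alt[of z] by linarith
qed

lemma kernel_vector: "\<exists>x. x \<noteq> 0 \<and> (\<forall>w. b x w = 0) \<and> (\<forall>w. b w x = 0)"
proof -
  have "0 \<in> {v. \<forall>w. b v w = 0}" by (simp add: bilinear_simps)
  then obtain x where x: "x \<noteq> 0" "\<forall>w. b x w = 0" using degenerate by blast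
  then have "b w x = 0" for w using skew[of w x] by simp
  with x show ?thesis by blast
qed

text \<open>From right to left, a vector of ker a that is orthogonal to ker a is also orthogonal to
  ker b by skew symmetry, hence to the whole space; so it lies in the intersection of the two
  kernels.\<close>

lemma nondegenerate_ker_iff_direct_sum:
  "(\<forall>v. a v = 0 \<and> (\<forall>w. a w = 0 \<longrightarrow> b v w = 0) \<longrightarrow> v = 0) \<longleftrightarrow>
   (\<forall>w. \<exists>h v. w = h + v \<and> a h = 0 \<and> (\<forall>w. b v w = 0)) \<and>
   (\<forall>v. a v = 0 \<and> (\<forall>w. b v w = 0) \<longrightarrow> v = 0)"
  (is "?nondeg \<longleftrightarrow> ?sum \<and> ?int")
proof
  assume nondeg: ?nondeg
  obtain x where x: "x \<noteq> 0" "\<forall>w. b x w = 0" "\<forall>w. b w x = 0" using kernel_vector by blast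
  have ax: "a x \<noteq> 0" using nondeg x by blast
  have ?sum
  proof
    fix w
    \<comment> \<open>Projection onto ker a along \<open>x\<close>: the coefficient is the one for
      which \<open>a\<close> vanishes on the remainder.\<close>
    have "w = (w - (a w / a x) *\<^sub>R x) + (a w / a x) *\<^sub>R x \<and>
        a (w - (a w / a x) *\<^sub>R x) = 0 \<and> (\<forall>z. b ((a w / a x) *\<^sub>R x) z = 0)"
      using ax x(2) by (simp add: bilinear_simps)
    then show "\<exists>h v. w = h + v \<and> a h = 0 \<and> (\<forall>w. b v w = 0)" by blast
  qed
  moreover have ?int using nondeg by blast
  ultimately show "?sum \<and> ?int" ..
next
  assume R: "?sum \<and> ?int"
  note sum = conjunct1[OF R] and int = conjunct2[OF R]
  show ?nondeg
  proof (intro allI impI, elim conjE)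
    fix v assume v: "a v = 0" "\<forall>w. a w = 0 \<longrightarrow> b v w = 0"
    have "b v w = 0" for w
    proof -
      obtain h k where "w = h + k" "a h = 0" "\<forall>w. b k w = 0"
        using sum[THEN spec, of w] by blast
      then show ?thesis using v(2) skew[of v k] by (simp add: bilinear_simps)
    qed
    then show "v = 0" using int v(1) by blast
  qed
qed

lemma nondegenerate_ker_iff_flat_inj:
  "(\<forall>v. a v = 0 \<and> (\<forall>w. a w = 0 \<longrightarrow> b v w = 0) \<longrightarrow> v = 0) \<longleftrightarrow>
   (\<forall>v. (\<forall>w. b v w + a v * a w = 0) \<longrightarrow> v = 0)"
  (is "?nondeg \<longleftrightarrow> ?inj")
proof
  assume nondeg: ?nondeg
  obtain x where x: "x \<noteq> 0" "\<forall>w. b x w = 0" "\<forall>w. b w x = 0" using kernel_vector by blast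
  have ax: "a x \<noteq> 0" using nondeg x by blast
  show ?inj
  proof (intro allI impI)
    fix v assume v: "\<forall>w. b v w + a v * a w = 0"
    have "a v = 0" using v[THEN spec, of x] x(3) ax by simp
    then show "v = 0" using nondeg v by simp
  qed
next
  assume inj: ?inj
  obtain x where x: "x \<noteq> 0" "\<forall>w. b x w = 0" "\<forall>w. b w x = 0" using kernel_vector by blast
  \<comment> \<open>If \<open>a x\<close> were 0, the non-zero \<open>x\<close> would satisfy the
    premise of \<open>?inj\<close>.\<close>
  have ax: "a x \<noteq> 0" using inj x by auto
  show ?nondeg
  proof (intro allI impI, elim conjE)
    fix v assume v: "a v = 0" "\<forall>w. a w = 0 \<longrightarrow> b v w = 0"
    \<comment> \<open>The projection of \<open>w\<close> along \<open>x\<close> lies in ker a, and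
      \<open>b v\<close> does not notice the subtracted multiple of \<open>x\<close>.\<close>
    have "b v w = 0" for w
      using v(2)[THEN spec, of "w - (a w / a x) *\<^sub>R x"] ax x(3) by (simp add: bilinear_simps)
    then show "v = 0" using inj v(1) by simp
  qed
qed

end

section \<open>Smooth curves of forms\<close>

text \<open>Continuity of scalar multiplication at \<open>(0, x)\<close> gives a neighbourhood of
  \<open>x\<close> that all sufficiently small scalars carry into \<open>U\<close>. Finitely many
  such neighbourhoods cover \<open>K\<close>, and one scalar works for all of them.\<close>

lemma compact_imp_tvs_bounded:
  fixes K :: "'e::locally_convex_space set"
  assumes "compact K"
  shows "tvs_bounded K"
  unfolding tvs_bounded_def
proof (intro allI impI, elim conjE)
  fix U :: "'e set" assume U: "open U" "0 \<in> U"
  have "\<exists>\<epsilon> N. \<epsilon> > 0 \<and> open N \<and> x \<in> N \<and> (\<forall>s z. \<bar>s\<bar> < \<epsilon> \<longrightarrow> z \<in> N \<longrightarrow> s *\<^sub>R z \<in> U)" for x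
  proof -
    have "\<forall>\<^sub>F q in nhds 0 \<times>\<^sub>F nhds x. fst q *\<^sub>R snd q \<in> U"
      using topological_tendstoD[OF tendsto_scaleR_Pair[of 0 x] U(1)] U(2) by simp
    then obtain P Q where PQ: "eventually P (nhds 0)" "eventually Q (nhds x)"
      "\<And>s z. P s \<Longrightarrow> Q z \<Longrightarrow> s *\<^sub>R z \<in> U"
      unfolding eventually_prod_filter by auto
    obtain \<epsilon> where "\<epsilon> > 0" "\<And>s::real. \<bar>s\<bar> < \<epsilon> \<Longrightarrow> P s"
      using PQ(1) unfolding eventually_nhds_metric dist_real_def by auto
    moreover obtain N where "open N" "x \<in> N" "\<And>z. z \<in> N \<Longrightarrow> Q z"
      using PQ(2) unfolding eventually_nhds by auto
    ultimately show ?thesis using PQ(3) by metis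
  qed
  then obtain \<epsilon> N where eN: "\<And>x. \<epsilon> x > (0::real)" "\<And>x. open (N x)" "\<And>x. x \<in> N x"
    "\<And>x s z. \<bar>s\<bar> < \<epsilon> x \<Longrightarrow> z \<in> N x \<Longrightarrow> s *\<^sub>R z \<in> U"
    by metis
  have "K \<subseteq> (\<Union>x\<in>K. N x)" using eN(3) by blast
  then obtain T where T: "T \<subseteq> K" "finite T" "K \<subseteq> (\<Union>x\<in>T. N x)"
    by (rule compactE_image[OF assms eN(2)])
  \<comment> \<open>Inserting 1 keeps the minimum meaningful when \<open>T\<close> is empty; halving
    makes \<open>d\<close> strictly smaller than every bound.\<close>
  define d where "d = Min (insert 1 (\<epsilon> ` T)) / 2"
  have "Min (insert 1 (\<epsilon> ` T)) > 0"
    using T(2) eN(1) by simp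
  then have d: "d > 0" "d < Min (insert 1 (\<epsilon> ` T))"
    by (auto simp: d_def)
  have "x \<in> (\<lambda>x. inverse d *\<^sub>R x) ` U" if "x \<in> K" for x
  proof -
    obtain y where y: "y \<in> T" "x \<in> N y" using T(3) \<open>x \<in> K\<close> by blast
    have "d < \<epsilon> y"
      using d(2) T(2) y(1) by simp
    then have "d *\<^sub>R x \<in> U"
      using eN(4)[of d y x] y(2) d(1) by simp
    then show ?thesis
      using d(1) by (intro image_eqI[of _ _ "d *\<^sub>R x"]) auto
  qed
  then show "\<exists>r>0. K \<subseteq> (\<lambda>x. r *\<^sub>R x) ` U"
    using d(1) by (intro exI[of _ "inverse d"]) auto
qed

lemma curve_segment_tvs_bounded:
  fixes x :: "real \<Rightarrow> 'e::locally_convex_space"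
  assumes "\<And>t. isCont x t"
  shows "tvs_bounded (x ` {a..b})"
  by (intro compact_imp_tvs_bounded compact_continuous_image continuous_at_imp_continuous_on
      ballI assms compact_Icc)

lemma eventually_at_0_segment: "\<forall>\<^sub>F h in at 0. t + h \<in> {t - 1..t + 1 :: real}"
  unfolding eventually_at by (intro exI[of _ 1]) (auto simp: dist_real_def)

section \<open>Continuous forms on bounded sets\<close>

lemma continuous_1_forms_add:
  "a \<in> continuous_1_forms \<Longrightarrow> b \<in> continuous_1_forms \<Longrightarrow> a + b \<in> continuous_1_forms"
  unfolding continuous_1_forms_def plus_fun_def
  by (auto intro: linear_compose_add continuous_on_add)

lemma continuous_1_forms_scale:
  "a \<in> continuous_1_forms \<Longrightarrow> (\<lambda>y. r * a y) \<in> continuous_1_forms"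
  unfolding continuous_1_forms_def
  using linear_compose_scale_right[of a r] by (auto intro: continuous_on_mult_left)

lemma continuous_2_forms_bilinear: "b \<in> continuous_2_forms \<Longrightarrow> bilinear (\<lambda>y z. b (y, z))"
  unfolding continuous_2_forms_def curry_def by simp

lemma continuous_2_forms_insert:
  assumes "b \<in> continuous_2_forms"
  shows "(\<lambda>y. b (x, y)) \<in> continuous_1_forms"
proof -
  have "linear (\<lambda>y. b (x, y))"
    using continuous_2_forms_bilinear[OF assms] unfolding bilinear_def by blast
  moreover have "continuous_on UNIV b"
    using assms by (simp add: continuous_2_forms_def)
  then have "continuous_on UNIV (\<lambda>y. b (x, y))"
    by (rule continuous_on_compose2) (auto intro!: continuous_intros)
  ultimately show ?thesis
    by (simp add: continuous_1_forms_def)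
qed

lemma continuous_1_form_tendsto:
  assumes "a \<in> continuous_1_forms" and "(f \<longlongrightarrow> l) F"
  shows "((\<lambda>h. a (f h)) \<longlongrightarrow> a l) F"
  using assms isCont_tendsto_compose[of l a f F]
  by (simp add: continuous_1_forms_def continuous_on_eq_continuous_at)

text \<open>A multiple of the neighbourhood of 0 on which \<open>a\<close> is below 1 in absolute
  value absorbs \<open>B\<close>. This is needed because products of uniform limits converge
  uniformly only under boundedness.\<close>

lemma continuous_1_form_bounded:
  assumes "a \<in> continuous_1_forms" and "tvs_bounded B"
  shows "bounded (a ` B)"
proof -
  have a: "linear a" "continuous_on UNIV a"
    using assms(1) by (auto simp: continuous_1_forms_def)
  have "open (a -` {-1<..<1})"
    using a(2) by (simp add: open_vimage)
  moreover have "0 \<in> a -` {-1<..<1}"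
    using linear_0[OF a(1)] by simp
  ultimately obtain r where r: "r > 0" "B \<subseteq> (\<lambda>x. r *\<^sub>R x) ` (a -` {-1<..<1})"
    using assms(2) unfolding tvs_bounded_def by meson
  have "\<bar>a x\<bar> \<le> r" if x: "x \<in> B" for x
  proof -
    obtain y where y: "y \<in> a -` {-1<..<1}" "x = r *\<^sub>R y" using r(2) x by blast
    from y(1) have "\<bar>a y\<bar> < 1" by auto
    with y(2) show ?thesis using r(1) linear_cmul[OF a(1), of r y] by (simp add: abs_mult)
  qed
  then show ?thesis
    unfolding bounded_iff by (intro exI[of _ r]) auto
qed

text \<open>Continuity of \<open>b\<close> at the origin controls it on a product
  \<open>U \<times> V\<close>. The factor \<open>r\<close> that makes \<open>V\<close> absorb
  \<open>C\<close> is moved by bilinearity from the second argument to the first, where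
  \<open>f h - l\<close> tends to 0 and can afford it.\<close>

lemma continuous_2_form_uniform_limit:
  fixes f :: "'h \<Rightarrow> 'e::locally_convex_space"
  assumes b: "b \<in> continuous_2_forms" and C: "tvs_bounded C" and f: "(f \<longlongrightarrow> l) F"
  shows "uniform_limit C (\<lambda>h y. b (f h, y)) (\<lambda>y. b (l, y)) F"
proof (rule uniform_limitI)
  fix e :: real assume e: "e > 0"
  note bil = continuous_2_forms_bilinear[OF b]
  have "open (b -` {-e<..<e})"
    using b by (simp add: continuous_2_forms_def open_vimage)
  moreover have "(0, 0) \<in> b -` {-e<..<e}"
    using bilinear_lzero[OF bil, of 0] e by simp
  ultimately obtain U V where UV: "open U" "open V" "0 \<in> U" "0 \<in> V" "U \<times> V \<subseteq> b -` {-e<..<e}"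
    by (rule open_prod_elim) auto
  obtain r where r: "r > 0" "C \<subseteq> (\<lambda>x. r *\<^sub>R x) ` V"
    using C UV(2,4) unfolding tvs_bounded_def by meson
  have "((\<lambda>h. r *\<^sub>R (f h - l)) \<longlongrightarrow> r *\<^sub>R (l - l)) F"
    using f by (intro tvs_tendsto_scaleR tendsto_intros)
  then have "\<forall>\<^sub>F h in F. r *\<^sub>R (f h - l) \<in> U"
    using UV(1,3) by (intro topological_tendstoD) auto
  then show "\<forall>\<^sub>F h in F. \<forall>y\<in>C. dist (b (f h, y)) (b (l, y)) < e"
  proof eventually_elim
    case (elim h)
    show ?case
    proof
      fix y assume "y \<in> C"
      then obtain v where v: "v \<in> V" "y = r *\<^sub>R v" using r(2) by blast
      have "b (f h, y) - b (l, y) = b (r *\<^sub>R (f h - l), v)"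
        unfolding v(2) bilinear_lmul[OF bil] bilinear_rmul[OF bil] bilinear_lsub[OF bil]
        by (simp add: algebra_simps)
      moreover have "(r *\<^sub>R (f h - l), v) \<in> b -` {-e<..<e}"
        using UV(5) elim v(1) by blast
      then have "\<bar>b (r *\<^sub>R (f h - l), v)\<bar> < e"
        by auto
      ultimately show "dist (b (f h, y)) (b (l, y)) < e"
        by (simp add: dist_real_def)
    qed
  qed
qed

text \<open>The Leibniz rule for inserting a curve. The quotient splits into the error
  \<open>?q h - b'\<close> at \<open>(x (t + h), y)\<close>, the value of \<open>b'\<close> there,
  and \<open>b t\<close> applied to the difference quotient of \<open>x\<close>; the three parts
  have the limits 0, \<open>b' (x t, y)\<close> and \<open>b t (x', y)\<close>.\<close>

lemma uniform_limit_insert_curve: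
  fixes x :: "real \<Rightarrow> 'e::locally_convex_space"
  assumes lim: "\<And>B C. tvs_bounded B \<Longrightarrow> tvs_bounded C \<Longrightarrow>
      uniform_limit (B \<times> C) (\<lambda>h z. (b (t + h) z - b t z) / h) b' (at 0)"
    and b: "b t \<in> continuous_2_forms" and b': "b' \<in> continuous_2_forms"
    and x: "\<And>t. isCont x t" and x': "has_curve_derivative x x' t" and C: "tvs_bounded C"
  shows "uniform_limit C (\<lambda>h y. (b (t + h) (x (t + h), y) - b t (x t, y)) / h)
    (\<lambda>y. b' (x t, y) + b t (x', y)) (at 0)"
proof -
  let ?B = "x ` {t - 1..t + 1}"
  let ?q = "\<lambda>h z. (b (t + h) z - b t z) / h"
  note bil = continuous_2_forms_bilinear[OF b]
  \<comment> \<open>The point \<open>x (t + h)\<close> moves with \<open>h\<close>, but for small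
    \<open>h\<close> it stays in the bounded segment \<open>?B\<close>, on which the convergence is
    uniform.\<close>
  have 1: "uniform_limit C (\<lambda>h y. ?q h (x (t + h), y) - b' (x (t + h), y)) (\<lambda>y. 0) (at 0)"
  proof (rule uniform_limitI)
    fix e :: real assume "e > 0"
    from uniform_limitD[OF lim[OF curve_segment_tvs_bounded[OF x] C] this]
    have "\<forall>\<^sub>F h in at 0. \<forall>z\<in>?B \<times> C. dist (?q h z) (b' z) < e" .
    then show "\<forall>\<^sub>F h in at 0. \<forall>y\<in>C. dist (?q h (x (t + h), y) - b' (x (t + h), y)) 0 < e"
      using eventually_at_0_segment[of t]
    proof eventually_elim
      case (elim h)
      show ?case
      proof
        fix y assume "y \<in> C"
        then have "(x (t + h), y) \<in> ?B \<times> C" using elim(2) by blast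
        from bspec[OF elim(1) this] show "dist (?q h (x (t + h), y) - b' (x (t + h), y)) 0 < e"
          by (simp add: dist_real_def)
      qed
    qed
  qed
  have "((\<lambda>h. x (t + h)) \<longlongrightarrow> x t) (at 0)"
    using x[of t] by (simp add: isCont_def LIM_offset_zero_iff)
  then have 2: "uniform_limit C (\<lambda>h y. b' (x (t + h), y)) (\<lambda>y. b' (x t, y)) (at 0)"
    by (rule continuous_2_form_uniform_limit[OF b' C])
  have 3: "uniform_limit C (\<lambda>h y. b t ((x (t + h) - x t) /\<^sub>R h, y)) (\<lambda>y. b t (x', y)) (at 0)"
    using x' unfolding has_curve_derivative_def by (rule continuous_2_form_uniform_limit[OF b C])
  have "(\<lambda>h y. (?q h (x (t + h), y) - b' (x (t + h), y)) + b' (x (t + h), y) +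
      b t ((x (t + h) - x t) /\<^sub>R h, y)) =
    (\<lambda>h y. (b (t + h) (x (t + h), y) - b t (x t, y)) / h)"
    unfolding bilinear_lmul[OF bil] bilinear_lsub[OF bil]
    by (simp add: fun_eq_iff divide_inverse algebra_simps)
  with uniform_limit_add[OF uniform_limit_add[OF 1 2] 3] show ?thesis
    by simp
qed

lemma curve_derivative_1_form_apply:
  fixes x :: "real \<Rightarrow> 'e::locally_convex_space"
  assumes lim: "\<And>B. tvs_bounded B \<Longrightarrow> uniform_limit B (\<lambda>h z. (a (t + h) z - a t z) / h) a' (at 0)"
    and a: "a t \<in> continuous_1_forms" and a': "a' \<in> continuous_1_forms"
    and x: "\<And>t. isCont x t" and x': "has_curve_derivative x x' t"
  shows "has_curve_derivative (\<lambda>s. a s (x s)) (a' (x t) + a t x') t"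
proof -
  let ?B = "x ` {t - 1..t + 1}"
  let ?q = "\<lambda>h z. (a (t + h) z - a t z) / h"
  have lin: "linear (a t)" using a by (simp add: continuous_1_forms_def)
  have 1: "((\<lambda>h. ?q h (x (t + h)) - a' (x (t + h))) \<longlongrightarrow> 0) (at 0)"
  proof (rule tendstoI)
    fix e :: real assume "e > 0"
    from uniform_limitD[OF lim[OF curve_segment_tvs_bounded[OF x]] this]
    have "\<forall>\<^sub>F h in at 0. \<forall>z\<in>?B. dist (?q h z) (a' z) < e" .
    then show "\<forall>\<^sub>F h in at 0. dist (?q h (x (t + h)) - a' (x (t + h))) 0 < e"
      using eventually_at_0_segment[of t]
      by eventually_elim (simp add: dist_real_def)
  qed
  have "((\<lambda>h. x (t + h)) \<longlongrightarrow> x t) (at 0)"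
    using x[of t] by (simp add: isCont_def LIM_offset_zero_iff)
  then have 2: "((\<lambda>h. a' (x (t + h))) \<longlongrightarrow> a' (x t)) (at 0)"
    by (rule continuous_1_form_tendsto[OF a'])
  have 3: "((\<lambda>h. a t ((x (t + h) - x t) /\<^sub>R h)) \<longlongrightarrow> a t x') (at 0)"
    using x' unfolding has_curve_derivative_def by (rule continuous_1_form_tendsto[OF a])
  have "(\<lambda>h. (?q h (x (t + h)) - a' (x (t + h))) + a' (x (t + h)) +
      a t ((x (t + h) - x t) /\<^sub>R h)) = (\<lambda>h. (a (t + h) (x (t + h)) - a t (x t)) /\<^sub>R h)"
    unfolding linear_cmul[OF lin] linear_diff[OF lin]
    by (simp add: fun_eq_iff divide_inverse algebra_simps)
  with tendsto_add[OF tendsto_add[OF 1 2] 3] show ?thesis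
    unfolding has_curve_derivative_def by simp
qed

lemma uniform_limit_scale_curve:
  fixes g :: "real \<Rightarrow> real"
  assumes lim: "uniform_limit B (\<lambda>h y. (a (t + h) y - a t y) / h) a' (at 0)"
    and g: "has_curve_derivative g g' t"
    and bnd: "bounded (a t ` B)" "bounded (a' ` B)"
  shows "uniform_limit B (\<lambda>h y. (g (t + h) * a (t + h) y - g t * a t y) / h)
    (\<lambda>y. g' * a t y + g t * a' y) (at 0)"
proof -
  have const: "uniform_limit B (\<lambda>h y. k h) (\<lambda>y. l) (at 0)" if "(k \<longlongrightarrow> l) (at 0)"
    for k :: "real \<Rightarrow> real" and l
    using that by (auto simp: uniform_limit_iff tendsto_iff elim!: eventually_mono)
  have bnd_const: "bounded ((\<lambda>y. l) ` B)" for l :: real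
    by (rule bounded_subset[of "{l}"]) auto
  \<comment> \<open>Differentiability uniformly on \<open>B\<close> entails continuity uniformly on
    \<open>B\<close>: for \<open>h\<close> other than 0, \<open>a (t + h)\<close> is
    \<open>h\<close> times its quotient plus \<open>a t\<close>.\<close>
  have "uniform_limit B (\<lambda>h y. h * ((a (t + h) y - a t y) / h)) (\<lambda>y. 0 * a' y) (at 0)"
    by (intro uniform_lim_mult const tendsto_ident_at lim bnd_const bnd)
  moreover have "uniform_limit B (\<lambda>h. a t) (a t) (at 0)"
    by (rule uniform_limit_const)
  ultimately have "uniform_limit B (\<lambda>h y. h * ((a (t + h) y - a t y) / h) + a t y)
      (\<lambda>y. 0 * a' y + a t y) (at 0)"
    by (rule uniform_limit_add)
  then have "uniform_limit B (\<lambda>h y. h * ((a (t + h) y - a t y) / h) + a t y) (a t) (at 0)"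
    by simp
  moreover have "\<forall>\<^sub>F h in at 0. \<forall>y\<in>B. h * ((a (t + h) y - a t y) / h) + a t y = a (t + h) y"
    by (auto simp: eventually_at_filter)
  ultimately have cont: "uniform_limit B (\<lambda>h. a (t + h)) (a t) (at 0)"
    by (rule uniform_limit_cong[THEN iffD1, rotated 2]) auto
  have "uniform_limit B (\<lambda>h y. ((g (t + h) - g t) /\<^sub>R h) * a (t + h) y) (\<lambda>y. g' * a t y) (at 0)"
    using g unfolding has_curve_derivative_def
    by (intro uniform_lim_mult const cont bnd_const bnd)
  moreover have "uniform_limit B (\<lambda>h y. g t * ((a (t + h) y - a t y) / h)) (\<lambda>y. g t * a' y) (at 0)"
    by (intro uniform_lim_mult const tendsto_const lim bnd_const bnd)
  ultimately have "uniform_limit B (\<lambda>h y. ((g (t + h) - g t) /\<^sub>R h) * a (t + h) y +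
      g t * ((a (t + h) y - a t y) / h)) (\<lambda>y. g' * a t y + g t * a' y) (at 0)"
    by (rule uniform_limit_add)
  moreover have "((g (t + h) - g t) /\<^sub>R h) * a (t + h) y + g t * ((a (t + h) y - a t y) / h)
      = (g (t + h) * a (t + h) y - g t * a t y) / h" for h y
    by (simp add: divide_inverse algebra_simps)
  ultimately show ?thesis by simp
qed

section \<open>Closure properties of smooth curves of forms\<close>

abbreviation smooth_1_form_curve :: "(real \<Rightarrow> 'e::locally_convex_space \<Rightarrow> real) \<Rightarrow> bool" where
  "smooth_1_form_curve \<equiv> smooth_form_curve continuous_1_forms {B. tvs_bounded B}"

abbreviation smooth_2_form_curve :: "(real \<Rightarrow> 'e::locally_convex_space \<times> 'e \<Rightarrow> real) \<Rightarrow> bool" where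
  "smooth_2_form_curve \<equiv>
     smooth_form_curve continuous_2_forms {B \<times> C |B C. tvs_bounded B \<and> tvs_bounded C}"

lemma smooth_1_form_curve_coinduct:
  fixes F :: "'i \<Rightarrow> real \<Rightarrow> 'e::locally_convex_space \<Rightarrow> real"
  assumes "\<And>i t. F i t \<in> continuous_1_forms"
    and "\<And>i t B. tvs_bounded B \<Longrightarrow> uniform_limit B (\<lambda>h y. (F i (t + h) y - F i t y) / h)
           (\<lambda>y. F (l i) t y + F (r i) t y) (at 0)"
  shows "smooth_1_form_curve (F i)"
proof -
  let ?deriv = "\<lambda>a a'. \<forall>t. \<forall>B\<in>{B. tvs_bounded B}.
    uniform_limit B (\<lambda>h y. (a (t + h) y - a t y) / h) (a' t) (at 0)"
  have "\<exists>D. D 0 = F i \<and> (\<forall>n::nat. D n \<in> sum_closure (F ` UNIV) \<and> ?deriv (D n) (D (Suc n)))"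
  proof (rule derivation_sequence[where deriv = ?deriv and l = l and r = r])
    fix a a' b b' :: "real \<Rightarrow> 'e \<Rightarrow> real"
    assume "?deriv a a'" and "?deriv b b'"
    show "?deriv (a + b) (a' + b')"
    proof (intro allI ballI)
      fix t B assume "B \<in> {B::'e set. tvs_bounded B}"
      then have "uniform_limit B (\<lambda>h y. (a (t + h) y - a t y) / h + (b (t + h) y - b t y) / h)
          (\<lambda>y. a' t y + b' t y) (at 0)"
        using \<open>?deriv a a'\<close> \<open>?deriv b b'\<close> by (intro uniform_limit_add) auto
      moreover have "(a (t + h) y - a t y) / h + (b (t + h) y - b t y) / h
          = ((a + b) (t + h) y - (a + b) t y) / h" for h y
        by (simp add: diff_divide_distrib add_divide_distrib)
      moreover have "(\<lambda>y. a' t y + b' t y) = (a' + b') t"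
        by (simp add: fun_eq_iff)
      ultimately show "uniform_limit B (\<lambda>h y. ((a + b) (t + h) y - (a + b) t y) / h)
          ((a' + b') t) (at 0)"
        by simp
    qed
  next
    fix i
    have "(F (l i) + F (r i)) t = (\<lambda>y. F (l i) t y + F (r i) t y)" for t
      by (simp add: fun_eq_iff)
    then show "l i \<in> UNIV \<and> r i \<in> UNIV \<and> ?deriv (F i) (F (l i) + F (r i))"
      using assms(2) by simp
  qed simp
  then obtain D where D: "D 0 = F i" "\<And>n::nat. D n \<in> sum_closure (range F)"
    "\<And>n. ?deriv (D n) (D (Suc n))"
    by blast
  \<comment> \<open>A smooth curve of forms must have all its derivatives in the space of forms;
    these are finite sums of members of \<open>F\<close>.\<close>
  have "a t \<in> continuous_1_forms" if "a \<in> sum_closure (range F)" for a t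
    using that
  proof induction
    case (base s)
    then show ?case using assms(1) by auto
  next
    case (add a b)
    show ?case by (subst plus_fun_apply) (rule continuous_1_forms_add[OF add.IH])
  qed
  then show ?thesis
    unfolding smooth_form_curve_def using D by (intro exI[of _ D]) simp
qed

lemma smooth_curve_isCont_derivatives:
  fixes x :: "real \<Rightarrow> 'e::real_topological_vector_space"
  assumes "smooth_curve x"
  obtains E where "E 0 = x" and "\<And>n t. has_curve_derivative (E n) (E (Suc n) t) t"
    and "\<And>n t. isCont (E n) t"
proof -
  obtain E where "E 0 = x" "\<And>n t. t \<in> UNIV \<Longrightarrow> has_curve_derivative (E n) (E (Suc n) t) t"
    by (rule smooth_curve_on_derivatives[OF assms open_UNIV]) (rule that)
  then show thesis
    using that[of E] has_curve_derivative_imp_isCont by blast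
qed

text \<open>The family is doubly indexed by the order of the derivative of the form and that of the
  vector; the Leibniz rule raises one index at a time. The next two results follow the same
  pattern.\<close>

lemma smooth_1_form_curve_insert:
  fixes x :: "real \<Rightarrow> 'e::locally_convex_space"
  assumes "smooth_2_form_curve b" and "smooth_curve x"
  shows "smooth_1_form_curve (\<lambda>t y. b t (x t, y))"
proof -
  obtain E where E: "E 0 = x" "\<And>n t. has_curve_derivative (E n) (E (Suc n) t) t"
    "\<And>n t. isCont (E n) t"
    by (rule smooth_curve_isCont_derivatives[OF assms(2)]) (rule that)
  obtain D where D: "D 0 = b" "\<And>n t. D n t \<in> continuous_2_forms"
    "\<And>n t B C. tvs_bounded B \<Longrightarrow> tvs_bounded C \<Longrightarrow>
       uniform_limit (B \<times> C) (\<lambda>h z. (D n (t + h) z - D n t z) / h) (D (Suc n) t) (at 0)"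
    using assms(1) unfolding smooth_form_curve_def by blast
  let ?F = "\<lambda>i t y. D (fst i) t (E (snd i) t, y)"
  have "smooth_1_form_curve (?F (0, 0))"
  proof (rule smooth_1_form_curve_coinduct[where F = ?F and l = "\<lambda>i. (Suc (fst i), snd i)"
        and r = "\<lambda>i. (fst i, Suc (snd i))"])
    fix i t and B :: "'e set" assume B: "tvs_bounded B"
    show "uniform_limit B (\<lambda>h y. (?F i (t + h) y - ?F i t y) / h)
        (\<lambda>y. ?F (Suc (fst i), snd i) t y + ?F (fst i, Suc (snd i)) t y) (at 0)"
      unfolding fst_conv snd_conv by (rule uniform_limit_insert_curve[OF D(3,2,2) E(3,2) B])
  qed (rule continuous_2_forms_insert[OF D(2)])
  then show ?thesis by (simp add: D(1) E(1))
qed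

lemma smooth_curve_1_form_apply:
  fixes x :: "real \<Rightarrow> 'e::locally_convex_space"
  assumes "smooth_1_form_curve a" and "smooth_curve x"
  shows "smooth_curve (\<lambda>t. a t (x t))"
proof -
  obtain E where E: "E 0 = x" "\<And>n t. has_curve_derivative (E n) (E (Suc n) t) t"
    "\<And>n t. isCont (E n) t"
    by (rule smooth_curve_isCont_derivatives[OF assms(2)]) (rule that)
  obtain D where D: "D 0 = a" "\<And>n t. D n t \<in> continuous_1_forms"
    "\<And>n t B. tvs_bounded B \<Longrightarrow>
       uniform_limit B (\<lambda>h z. (D n (t + h) z - D n t z) / h) (D (Suc n) t) (at 0)"
    using assms(1) unfolding smooth_form_curve_def by blast
  let ?F = "\<lambda>i t. D (fst i) t (E (snd i) t)"
  have "smooth_curve (?F (0, 0))"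
  proof (rule smooth_curve_on_coinduct[where F = ?F and I = UNIV
        and l = "\<lambda>i. (Suc (fst i), snd i)" and r = "\<lambda>i. (fst i, Suc (snd i))"])
    show "has_curve_derivative (?F i) (?F (Suc (fst i), snd i) t + ?F (fst i, Suc (snd i)) t) t" for i t
      unfolding fst_conv snd_conv by (rule curve_derivative_1_form_apply[OF D(3,2,2) E(3,2)])
  qed simp_all
  then show ?thesis by (simp add: D(1) E(1))
qed

lemma smooth_1_form_curve_scale:
  fixes a :: "real \<Rightarrow> 'e::locally_convex_space \<Rightarrow> real"
  assumes "smooth_curve g" and "smooth_1_form_curve a"
  shows "smooth_1_form_curve (\<lambda>t y. g t * a t y)"
proof -
  obtain G where G: "G 0 = g" "\<And>n t. has_curve_derivative (G n) (G (Suc n) t) t"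
    "\<And>n t. isCont (G n) t"
    by (rule smooth_curve_isCont_derivatives[OF assms(1)]) (rule that)
  obtain D where D: "D 0 = a" "\<And>n t. D n t \<in> continuous_1_forms"
    "\<And>n t B. tvs_bounded B \<Longrightarrow>
       uniform_limit B (\<lambda>h z. (D n (t + h) z - D n t z) / h) (D (Suc n) t) (at 0)"
    using assms(2) unfolding smooth_form_curve_def by blast
  let ?F = "\<lambda>i t y. G (fst i) t * D (snd i) t y"
  have "smooth_1_form_curve (?F (0, 0))"
  proof (rule smooth_1_form_curve_coinduct[where F = ?F and l = "\<lambda>i. (Suc (fst i), snd i)"
        and r = "\<lambda>i. (fst i, Suc (snd i))"])
    fix i t and B :: "'e set" assume B: "tvs_bounded B"
    show "uniform_limit B (\<lambda>h y. (?F i (t + h) y - ?F i t y) / h)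
        (\<lambda>y. ?F (Suc (fst i), snd i) t y + ?F (fst i, Suc (snd i)) t y) (at 0)"
      unfolding fst_conv snd_conv
      by (rule uniform_limit_scale_curve[OF D(3)[OF B] G(2)
            continuous_1_form_bounded[OF D(2) B] continuous_1_form_bounded[OF D(2) B]])
  qed (rule continuous_1_forms_scale[OF D(2)])
  then show ?thesis by (simp add: D(1) G(1))
qed

lemma smooth_1_form_curve_add:
  fixes a b :: "real \<Rightarrow> 'e::locally_convex_space \<Rightarrow> real"
  assumes "smooth_1_form_curve a" and "smooth_1_form_curve b"
  shows "smooth_1_form_curve (\<lambda>t y. a t y + b t y)"
proof -
  obtain D where D: "D 0 = a" "\<And>n t. D n t \<in> continuous_1_forms"
    "\<And>n t B. tvs_bounded B \<Longrightarrow>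
       uniform_limit B (\<lambda>h z. (D n (t + h) z - D n t z) / h) (D (Suc n) t) (at 0)"
    using assms(1) unfolding smooth_form_curve_def by blast
  obtain E where E: "E 0 = b" "\<And>n t. E n t \<in> continuous_1_forms"
    "\<And>n t B. tvs_bounded B \<Longrightarrow>
       uniform_limit B (\<lambda>h z. (E n (t + h) z - E n t z) / h) (E (Suc n) t) (at 0)"
    using assms(2) unfolding smooth_form_curve_def by blast
  let ?S = "\<lambda>n t y. D n t y + E n t y"
  have "uniform_limit B (\<lambda>h y. (?S n (t + h) y - ?S n t y) / h) (?S (Suc n) t) (at 0)"
    if "tvs_bounded B" for n t B
  proof -
    have "(D n (t + h) y - D n t y) / h + (E n (t + h) y - E n t y) / h
        = (?S n (t + h) y - ?S n t y) / h" for h y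
      by (simp add: diff_divide_distrib add_divide_distrib)
    with uniform_limit_add[OF D(3)[OF that, of n t] E(3)[OF that, of n t]] show ?thesis
      by simp
  qed
  moreover have "?S n t \<in> continuous_1_forms" for n t
    using continuous_1_forms_add[OF D(2) E(2)] unfolding plus_fun_def .
  ultimately show ?thesis
    unfolding smooth_form_curve_def by (intro exI[of _ ?S]) (simp add: D(1) E(1))
qed

lemma smooth_1_form_on_flat:
  fixes \<xi> :: "'e::convenient_vector_space \<Rightarrow> 'e"
  assumes "smooth_2_form_on W \<beta>" and "smooth_1_form_on W \<alpha>" and "smooth_map_on W \<xi>"
  shows "smooth_1_form_on W (\<lambda>x y. \<beta> x (\<xi> x, y) + \<alpha> x (\<xi> x) * \<alpha> x y)"
  unfolding smooth_1_form_on_def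
proof (intro allI impI)
  fix c assume c: "smooth_curve c \<and> range c \<subseteq> W"
  have \<alpha>: "smooth_1_form_curve (\<lambda>t. \<alpha> (c t))" and \<beta>: "smooth_2_form_curve (\<lambda>t. \<beta> (c t))"
    and \<xi>: "smooth_curve (\<lambda>t. \<xi> (c t))"
    using assms c unfolding smooth_1_form_on_def smooth_2_form_on_def smooth_map_on_def comp_def
    by blast+
  show "smooth_1_form_curve ((\<lambda>x y. \<beta> x (\<xi> x, y) + \<alpha> x (\<xi> x) * \<alpha> x y) \<circ> c)"
    unfolding comp_def
    by (intro smooth_1_form_curve_add smooth_1_form_curve_scale smooth_1_form_curve_insert
        smooth_curve_1_form_apply \<alpha> \<beta> \<xi>)
qed

lemma smooth_1_form_on_cong:
  assumes "smooth_1_form_on W f" and "\<And>x. x \<in> W \<Longrightarrow> f x = g x"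
  shows "smooth_1_form_on W g"
  unfolding smooth_1_form_on_def
proof (intro allI impI)
  fix c assume c: "smooth_curve c \<and> range c \<subseteq> W"
  then have "f \<circ> c = g \<circ> c"
    using assms(2) by (auto simp: fun_eq_iff)
  with c assms(1) show "smooth_1_form_curve (g \<circ> c)"
    unfolding smooth_1_form_on_def by metis
qed

section \<open>The map \<open>\<flat>\<close> and the conditions in coordinates\<close>

context convenient_mfd
begin

lemma flat_in_one_forms:
  assumes \<theta>: "\<theta> \<in> one_forms M A" and \<omega>: "\<omega> \<in> two_forms M A" and X: "X \<in> vector_fields M A"
  shows "flat M A \<theta> \<omega> X \<in> one_forms M A"
proof -
  have "smooth_1_form_on (u ` U)
      (\<lambda>x y. let p = inv_into U u x in flat M A \<theta> \<omega> X p (tangent_vector M A u p y))"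
    if Uu: "(U, u) \<in> A" for U u
  proof -
    let ?\<alpha> = "\<lambda>x y. let p = inv_into U u x in \<theta> p (tangent_vector M A u p y)"
    let ?\<beta> = "\<lambda>x (y, z). let p = inv_into U u x in
      \<omega> p (tangent_vector M A u p y) (tangent_vector M A u p z)"
    have "\<forall>(U, u)\<in>A. \<exists>\<xi>. smooth_map_on (u ` U) \<xi> \<and>
        (\<forall>p\<in>U. X p = tangent_vector M A u p (\<xi> (u p)))"
      using X unfolding vector_fields_def by blast
    from bspec[OF this Uu] obtain \<xi> where \<xi>: "smooth_map_on (u ` U) \<xi>"
      "\<forall>p\<in>U. X p = tangent_vector M A u p (\<xi> (u p))"
      by auto
    have "\<forall>(U, u)\<in>A. smooth_1_form_on (u ` U)
        (\<lambda>x y. let p = inv_into U u x in \<theta> p (tangent_vector M A u p y))"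
      using \<theta> unfolding one_forms_def by blast
    from bspec[OF this Uu] have \<alpha>: "smooth_1_form_on (u ` U) ?\<alpha>"
      by simp
    have "\<forall>(U, u)\<in>A. smooth_2_form_on (u ` U)
        (\<lambda>x (y, z). let p = inv_into U u x in
          \<omega> p (tangent_vector M A u p y) (tangent_vector M A u p z))"
      using \<omega> unfolding two_forms_def by blast
    from bspec[OF this Uu] have \<beta>: "smooth_2_form_on (u ` U) ?\<beta>"
      by simp
    show ?thesis
    proof (rule smooth_1_form_on_cong[OF smooth_1_form_on_flat[OF \<beta> \<alpha> \<xi>(1)]])
      fix x assume "x \<in> u ` U"
      then obtain p where p: "p \<in> U" "x = u p" by blast
      have inv: "inv_into U u x = p"
        using chart_inj_on[OF Uu] p by simp
      have "p \<in> M" using chart_subset[OF Uu] p(1) by blast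
      then show "(\<lambda>y. ?\<beta> x (\<xi> x, y) + ?\<alpha> x (\<xi> x) * ?\<alpha> x y) =
          (\<lambda>y. let p = inv_into U u x in flat M A \<theta> \<omega> X p (tangent_vector M A u p y))"
        using \<xi>(2) p tangent_vector_in_tangent_space[OF Uu p(1)]
        unfolding inv Let_def by (simp add: flat_def flat_at_def)
    qed
  qed
  moreover have "flat M A \<theta> \<omega> X \<in> (\<Pi>\<^sub>E p\<in>M. tangent_space M A p \<rightarrow>\<^sub>E UNIV)"
    unfolding flat_def flat_at_def by (simp add: restrict_PiE_iff)
  ultimately show ?thesis
    unfolding one_forms_def by blast
qed

lemma tangent_spaceE:
  assumes "p \<in> M" and "v \<in> tangent_space M A p"
  obtains y where "v = tv p y"
  using assms tangent_space_eq_range_tv by auto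

lemma vector_field_in_tangent_space:
  "X \<in> vector_fields M A \<Longrightarrow> p \<in> M \<Longrightarrow> X p \<in> tangent_space M A p"
  unfolding vector_fields_def by blast

lemma tv_in_tangent_space: "p \<in> M \<Longrightarrow> tv p y \<in> tangent_space M A p"
  by (simp add: tangent_space_eq_range_tv)

lemma flat_smooth_module_hom:
  assumes \<theta>: "\<theta> \<in> one_forms M A" and \<omega>: "\<omega> \<in> two_forms M A"
  shows "smooth_module_hom M A (flat M A \<theta> \<omega>)"
  unfolding smooth_module_hom_def
proof (intro conjI ballI)
  show "flat M A \<theta> \<omega> \<in> vector_fields M A \<rightarrow> one_forms M A"
    using flat_in_one_forms[OF assms] by blast
next
  fix X Y assume X: "X \<in> vector_fields M A" and Y: "Y \<in> vector_fields M A"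
  have "\<omega> p (tangent_add M A p (X p) (Y p)) w + \<theta> p (tangent_add M A p (X p) (Y p)) * \<theta> p w =
      (\<omega> p (X p) w + \<theta> p (X p) * \<theta> p w) + (\<omega> p (Y p) w + \<theta> p (Y p) * \<theta> p w)"
    if p: "p \<in> M" and w: "w \<in> tangent_space M A p" for p w
  proof -
    obtain x where x: "X p = tv p x"
      by (rule tangent_spaceE[OF p vector_field_in_tangent_space[OF X p]])
    obtain y where y: "Y p = tv p y"
      by (rule tangent_spaceE[OF p vector_field_in_tangent_space[OF Y p]])
    obtain z where z: "w = tv p z"
      by (rule tangent_spaceE[OF p w])
    have "\<theta> p (tv p (x + y)) = \<theta> p (tv p x) + \<theta> p (tv p y)"
      by (rule linear_add[OF one_form_linear[OF \<theta> p]])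
    moreover have "\<omega> p (tv p (x + y)) (tv p z) = \<omega> p (tv p x) (tv p z) + \<omega> p (tv p y) (tv p z)"
      by (rule bilinear_ladd[OF two_form_bilinear(1)[OF \<omega> p]])
    ultimately show ?thesis
      unfolding x y z tangent_add_tv[OF p] by (simp only: algebra_simps)
  qed
  then show "flat M A \<theta> \<omega> (\<lambda>p\<in>M. tangent_add M A p (X p) (Y p)) =
      (\<lambda>p\<in>M. \<lambda>w\<in>tangent_space M A p. flat M A \<theta> \<omega> X p w + flat M A \<theta> \<omega> Y p w)"
    unfolding flat_def flat_at_def by (intro restrict_ext) simp
next
  fix f X assume X: "X \<in> vector_fields M A"
  have "\<omega> p (tangent_scale M A p (f p) (X p)) w + \<theta> p (tangent_scale M A p (f p) (X p)) * \<theta> p w =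
      f p * (\<omega> p (X p) w + \<theta> p (X p) * \<theta> p w)"
    if p: "p \<in> M" and w: "w \<in> tangent_space M A p" for p w
  proof -
    obtain x where x: "X p = tv p x"
      by (rule tangent_spaceE[OF p vector_field_in_tangent_space[OF X p]])
    obtain z where z: "w = tv p z"
      by (rule tangent_spaceE[OF p w])
    have "\<theta> p (tv p (f p *\<^sub>R x)) = f p * \<theta> p (tv p x)"
      using linear_cmul[OF one_form_linear[OF \<theta> p]] by simp
    moreover have "\<omega> p (tv p (f p *\<^sub>R x)) (tv p z) = f p * \<omega> p (tv p x) (tv p z)"
      using bilinear_lmul[OF two_form_bilinear(1)[OF \<omega> p]] by simp
    ultimately show ?thesis
      unfolding x z tangent_scale_tv[OF p] by (simp only: algebra_simps)
  qed
  then show "flat M A \<theta> \<omega> (\<lambda>p\<in>M. tangent_scale M A p (f p) (X p)) =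
      (\<lambda>p\<in>M. \<lambda>w\<in>tangent_space M A p. f p * flat M A \<theta> \<omega> X p w)"
    unfolding flat_def flat_at_def by (intro restrict_ext) simp
qed

section \<open>The three conditions read off in the model space\<close>

lemma form_kernel1_tv:
  "p \<in> M \<Longrightarrow> tv p y \<in> form_kernel1 M A \<theta> p \<longleftrightarrow> \<theta> p (tv p y) = 0"
  by (simp add: form_kernel1_def tv_in_tangent_space)

lemma form_kernel2_tv:
  "p \<in> M \<Longrightarrow> tv p y \<in> form_kernel2 M A \<omega> p \<longleftrightarrow> (\<forall>z. \<omega> p (tv p y) (tv p z) = 0)"
  by (simp add: form_kernel2_def tangent_space_eq_range_tv)

lemma all_tangent_space_iff: "p \<in> M \<Longrightarrow> (\<forall>v\<in>tangent_space M A p. P v) \<longleftrightarrow> (\<forall>y. P (tv p y))"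
  by (simp add: tangent_space_eq_range_tv)

text \<open>Common form of three conditions: the kernel of \<omega>, the intersection of the two
  kernels and the radical of \<omega> on ker \<theta> being zero.\<close>

lemma subset_eq_zero_iff:
  assumes "p \<in> M" and "S \<subseteq> tangent_space M A p" and "tangent_zero M A p \<in> S"
  shows "S = {tangent_zero M A p} \<longleftrightarrow> (\<forall>y. tv p y \<in> S \<longrightarrow> y = 0)"
proof -
  have "S = {tangent_zero M A p} \<longleftrightarrow> (\<forall>v\<in>tangent_space M A p. v \<in> S \<longrightarrow> v = tangent_zero M A p)"
    using assms(2,3) by blast
  then show ?thesis
    unfolding all_tangent_space_iff[OF assms(1)] tangent_zero_def tv_eq_iff[OF assms(1)] .
qed

text \<open>\<open>flat\<close> acts point by point, and vector fields are extensional on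
  \<open>M\<close>; so injectivity on every fibre already separates global sections.\<close>

lemma flat_injective_iff:
  "flat_injective M A \<theta> \<omega> \<longleftrightarrow> (\<forall>p\<in>M. inj_on (flat_at M A \<theta> \<omega> p) (tangent_space M A p))"
proof -
  have "inj_on (flat M A \<theta> \<omega>) (vector_fields M A)"
    if inj: "\<forall>p\<in>M. inj_on (flat_at M A \<theta> \<omega> p) (tangent_space M A p)"
  proof (rule inj_onI)
    fix X Y assume X: "X \<in> vector_fields M A" and Y: "Y \<in> vector_fields M A"
      and eq: "flat M A \<theta> \<omega> X = flat M A \<theta> \<omega> Y"
    have "X p = Y p" if p: "p \<in> M" for p
    proof (rule inj_onD[OF bspec[OF inj p]])
      show "flat_at M A \<theta> \<omega> p (X p) = flat_at M A \<theta> \<omega> p (Y p)"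
        using fun_cong[OF eq, of p] p by (simp add: flat_def)
    qed (fact vector_field_in_tangent_space[OF X p] vector_field_in_tangent_space[OF Y p])+
    moreover have "X \<in> (\<Pi>\<^sub>E p\<in>M. tangent_space M A p)" "Y \<in> (\<Pi>\<^sub>E p\<in>M. tangent_space M A p)"
      using X Y unfolding vector_fields_def by blast+
    ultimately show "X = Y"
      by (intro PiE_ext)
  qed
  then show ?thesis
    unfolding flat_injective_def by blast
qed

context
  fixes \<theta> :: "'m form1" and \<omega> :: "'m form2" and p :: 'm
  assumes \<theta>: "\<theta> \<in> one_forms M A" and \<omega>: "\<omega> \<in> two_forms M A" and p: "p \<in> M"
begin

abbreviation (input) "a y \<equiv> \<theta> p (tv p y)"
abbreviation (input) "b y z \<equiv> \<omega> p (tv p y) (tv p z)"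

lemmas coordinate_simps = linear_0[OF one_form_linear[OF \<theta> p]]
  bilinear_lzero[OF two_form_bilinear(1)[OF \<omega> p]]
  linear_diff[OF one_form_linear[OF \<theta> p]]
  bilinear_lsub[OF two_form_bilinear(1)[OF \<omega> p]]

lemma zero_in_kernels:
  "tangent_zero M A p \<in> form_kernel1 M A \<theta> p" "tangent_zero M A p \<in> form_kernel2 M A \<omega> p"
  unfolding tangent_zero_def form_kernel1_tv[OF p] form_kernel2_tv[OF p]
  by (simp_all only: coordinate_simps) simp

lemma form_kernel2_eq_zero_iff:
  "form_kernel2 M A \<omega> p = {tangent_zero M A p} \<longleftrightarrow> {y. \<forall>z. b y z = 0} = {0}"
proof -
  have "form_kernel2 M A \<omega> p = {tangent_zero M A p} \<longleftrightarrow> (\<forall>y. (\<forall>z. b y z = 0) \<longrightarrow> y = 0)"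
    using subset_eq_zero_iff[OF p _ zero_in_kernels(2)]
    by (simp only: form_kernel2_tv[OF p]) (auto simp: form_kernel2_def)
  also have "\<dots> \<longleftrightarrow> {y. \<forall>z. b y z = 0} = {0}"
    using coordinate_simps(2) by blast
  finally show ?thesis .
qed

lemma nondegenerate_at_iff:
  "{v \<in> form_kernel1 M A \<theta> p. \<forall>w\<in>form_kernel1 M A \<theta> p. \<omega> p v w = 0} = {tangent_zero M A p} \<longleftrightarrow>
   (\<forall>y. a y = 0 \<and> (\<forall>z. a z = 0 \<longrightarrow> b y z = 0) \<longrightarrow> y = 0)"
proof -
  \<comment> \<open>The vector \<open>v\<close> stays arbitrary so that this equation can rewrite
    under the set comprehension that binds it.\<close>
  have H: "(\<forall>w\<in>form_kernel1 M A \<theta> p. \<omega> p v w = 0) \<longleftrightarrow> (\<forall>z. a z = 0 \<longrightarrow> \<omega> p v (tv p z) = 0)" for v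
  proof -
    have "(\<forall>w\<in>form_kernel1 M A \<theta> p. \<omega> p v w = 0) \<longleftrightarrow>
        (\<forall>w\<in>tangent_space M A p. \<theta> p w = 0 \<longrightarrow> \<omega> p v w = 0)"
      unfolding form_kernel1_def by blast
    then show ?thesis unfolding all_tangent_space_iff[OF p] .
  qed
  let ?S = "{v \<in> form_kernel1 M A \<theta> p. \<forall>w\<in>form_kernel1 M A \<theta> p. \<omega> p v w = 0}"
  have "?S \<subseteq> tangent_space M A p"
    unfolding form_kernel1_def by blast
  moreover have "\<forall>w\<in>form_kernel1 M A \<theta> p. \<omega> p (tangent_zero M A p) w = 0"
    unfolding H tangent_zero_def by (simp only: coordinate_simps) simp
  with zero_in_kernels(1) have "tangent_zero M A p \<in> ?S"
    by blast
  ultimately have "?S = {tangent_zero M A p} \<longleftrightarrow> (\<forall>y. tv p y \<in> ?S \<longrightarrow> y = 0)"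
    by (rule subset_eq_zero_iff[OF p])
  then show ?thesis
    unfolding mem_Collect_eq H form_kernel1_tv[OF p] .
qed

lemma direct_sum_at_iff:
  "tangent_space M A p =
     {tangent_add M A p h v |h v. h \<in> form_kernel1 M A \<theta> p \<and> v \<in> form_kernel2 M A \<omega> p} \<and>
   form_kernel1 M A \<theta> p \<inter> form_kernel2 M A \<omega> p = {tangent_zero M A p} \<longleftrightarrow>
   (\<forall>w. \<exists>h v. w = h + v \<and> a h = 0 \<and> (\<forall>w. b v w = 0)) \<and>
   (\<forall>v. a v = 0 \<and> (\<forall>w. b v w = 0) \<longrightarrow> v = 0)"
proof (intro conj_cong)
  have add: "tangent_add M A p h v = tv p w \<and> h \<in> form_kernel1 M A \<theta> p \<and> v \<in> form_kernel2 M A \<omega> p \<longleftrightarrow>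
      (\<exists>x y. h = tv p x \<and> v = tv p y \<and> w = x + y \<and> a x = 0 \<and> (\<forall>w. b y w = 0))" for h v w
  proof
    assume L: "tangent_add M A p h v = tv p w \<and> h \<in> form_kernel1 M A \<theta> p \<and> v \<in> form_kernel2 M A \<omega> p"
    then have hv: "h \<in> tangent_space M A p" "v \<in> tangent_space M A p"
      unfolding form_kernel1_def form_kernel2_def by blast+
    obtain x where x: "h = tv p x" by (rule tangent_spaceE[OF p hv(1)])
    obtain y where y: "v = tv p y" by (rule tangent_spaceE[OF p hv(2)])
    have "w = x + y" "a x = 0" "\<forall>w. b y w = 0"
      using L unfolding x y tangent_add_tv[OF p] tv_eq_iff[OF p] form_kernel1_tv[OF p]
        form_kernel2_tv[OF p] by blast+
    with x y show "\<exists>x y. h = tv p x \<and> v = tv p y \<and> w = x + y \<and> a x = 0 \<and> (\<forall>w. b y w = 0)"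
      by blast
  next
    assume "\<exists>x y. h = tv p x \<and> v = tv p y \<and> w = x + y \<and> a x = 0 \<and> (\<forall>w. b y w = 0)"
    then obtain x y where R: "h = tv p x" "v = tv p y" "w = x + y" "a x = 0" "\<forall>w. b y w = 0"
      by blast
    show "tangent_add M A p h v = tv p w \<and> h \<in> form_kernel1 M A \<theta> p \<and> v \<in> form_kernel2 M A \<omega> p"
      unfolding R(1-3) tangent_add_tv[OF p] form_kernel1_tv[OF p] form_kernel2_tv[OF p]
      using R(4,5) by blast
  qed
  let ?S = "{tangent_add M A p h v |h v. h \<in> form_kernel1 M A \<theta> p \<and> v \<in> form_kernel2 M A \<omega> p}"
  have "?S \<subseteq> tangent_space M A p"
    unfolding tangent_add_def using tv_in_tangent_space[OF p] by blast
  then have "tangent_space M A p = ?S \<longleftrightarrow> (\<forall>v\<in>tangent_space M A p. v \<in> ?S)"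
    by blast
  also have "\<dots> \<longleftrightarrow> (\<forall>w. tv p w \<in> ?S)"
    by (rule all_tangent_space_iff[OF p])
  also have "\<dots> \<longleftrightarrow> (\<forall>w. \<exists>h v. tangent_add M A p h v = tv p w \<and>
      h \<in> form_kernel1 M A \<theta> p \<and> v \<in> form_kernel2 M A \<omega> p)"
    by (simp only: mem_Collect_eq eq_commute[of "tv p _"])
  also have "\<dots> \<longleftrightarrow> (\<forall>w. \<exists>x y. w = x + y \<and> a x = 0 \<and> (\<forall>w. b y w = 0))"
    unfolding add
  proof (intro all_cong1 iffI; elim exE conjE)
    fix w x y assume "w = x + y" "a x = 0" "\<forall>w. b y w = 0"
    then show "\<exists>x y. w = x + y \<and> a x = 0 \<and> (\<forall>w. b y w = 0)"
      by (intro exI[of _ x] exI[of _ y] conjI)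
    from \<open>w = x + y\<close> \<open>a x = 0\<close> \<open>\<forall>w. b y w = 0\<close>
    show "\<exists>h v x y. h = tv p x \<and> v = tv p y \<and> w = x + y \<and> a x = 0 \<and> (\<forall>w. b y w = 0)"
      by (intro exI[of _ "tv p x"] exI[of _ "tv p y"] exI[of _ x] exI[of _ y] conjI refl)
  qed
  finally show "tangent_space M A p = ?S \<longleftrightarrow>
      (\<forall>w. \<exists>h v. w = h + v \<and> a h = 0 \<and> (\<forall>w. b v w = 0))" .
next
  let ?S = "form_kernel1 M A \<theta> p \<inter> form_kernel2 M A \<omega> p"
  have "?S \<subseteq> tangent_space M A p"
    unfolding form_kernel1_def by blast
  moreover have "tangent_zero M A p \<in> ?S"
    using zero_in_kernels by blast
  ultimately have "?S = {tangent_zero M A p} \<longleftrightarrow> (\<forall>y. tv p y \<in> ?S \<longrightarrow> y = 0)"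
    by (rule subset_eq_zero_iff[OF p])
  then show "?S = {tangent_zero M A p} \<longleftrightarrow> (\<forall>v. a v = 0 \<and> (\<forall>w. b v w = 0) \<longrightarrow> v = 0)"
    unfolding Int_iff form_kernel1_tv[OF p] form_kernel2_tv[OF p] .
qed

lemma flat_at_inj_iff:
  "inj_on (flat_at M A \<theta> \<omega> p) (tangent_space M A p) \<longleftrightarrow>
   (\<forall>v. (\<forall>w. b v w + a v * a w = 0) \<longrightarrow> v = 0)"
proof -
  \<comment> \<open>Linearity of both sides in coordinates turns injectivity into the vanishing of a
    kernel.\<close>
  have eq: "flat_at M A \<theta> \<omega> p (tv p x) = flat_at M A \<theta> \<omega> p (tv p y) \<longleftrightarrow>
      (\<forall>w. b (x - y) w + a (x - y) * a w = 0)" for x y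
  proof -
    have "flat_at M A \<theta> \<omega> p (tv p x) = flat_at M A \<theta> \<omega> p (tv p y) \<longleftrightarrow>
        (\<forall>w\<in>tangent_space M A p. \<omega> p (tv p x) w + \<theta> p (tv p x) * \<theta> p w =
          \<omega> p (tv p y) w + \<theta> p (tv p y) * \<theta> p w)"
      unfolding flat_at_def by (auto simp: fun_eq_iff restrict_def)
    also have "\<dots> \<longleftrightarrow> (\<forall>w. b x w + a x * a w = b y w + a y * a w)"
      by (rule all_tangent_space_iff[OF p])
    finally show ?thesis
      by (simp only: coordinate_simps) (simp add: algebra_simps)
  qed
  show ?thesis
  proof
    assume inj: "inj_on (flat_at M A \<theta> \<omega> p) (tangent_space M A p)"
    show "\<forall>v. (\<forall>w. b v w + a v * a w = 0) \<longrightarrow> v = 0"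
    proof (intro allI impI)
      fix v assume "\<forall>w. b v w + a v * a w = 0"
      then have "flat_at M A \<theta> \<omega> p (tv p v) = flat_at M A \<theta> \<omega> p (tv p 0)"
        unfolding eq diff_zero .
      then have "tv p v = tv p 0"
        by (rule inj_onD[OF inj _ tv_in_tangent_space[OF p] tv_in_tangent_space[OF p]])
      then show "v = 0"
        unfolding tv_eq_iff[OF p] .
    qed
  next
    assume R: "\<forall>v. (\<forall>w. b v w + a v * a w = 0) \<longrightarrow> v = 0"
    show "inj_on (flat_at M A \<theta> \<omega> p) (tangent_space M A p)"
    proof (rule inj_onI)
      fix v w assume v: "v \<in> tangent_space M A p" and w: "w \<in> tangent_space M A p"
        and fl: "flat_at M A \<theta> \<omega> p v = flat_at M A \<theta> \<omega> p w"
      obtain x where x: "v = tv p x" by (rule tangent_spaceE[OF p v])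
      obtain y where y: "w = tv p y" by (rule tangent_spaceE[OF p w])
      have "x - y = 0"
        using fl unfolding x y eq by (rule R[THEN spec, THEN mp])
      then show "v = w" by (simp add: x y)
    qed
  qed
qed

lemma degenerate_pair_at:
  "form_kernel2 M A \<omega> p \<noteq> {tangent_zero M A p} \<Longrightarrow>
   degenerate_pair (\<lambda>y. \<theta> p (tv p y)) (\<lambda>y z. \<omega> p (tv p y) (tv p z))"
  unfolding form_kernel2_eq_zero_iff
  by (intro degenerate_pair.intro one_form_linear[OF \<theta> p] two_form_bilinear[OF \<omega> p])

end

end

theorem theorem6p1:
  fixes M :: "'m set"
    and A :: "('m, 'e::convenient_vector_space) chart set"
    and \<theta> :: "'m form1" and \<omega> :: "'m form2"
    and H V :: "'m \<Rightarrow> (real \<Rightarrow> 'm) set set"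
  assumes "convenient_manifold M A"
    and "\<theta> \<in> one_forms M A"
    and "\<omega> \<in> two_forms M A"
    and "degenerate M A \<omega>"
  defines "H \<equiv> form_kernel1 M A \<theta>"
    and "V \<equiv> form_kernel2 M A \<omega>"
  shows "(tangent_bundle_direct_sum M A H V \<longleftrightarrow> weakly_nondegenerate_on M A \<omega> H) \<and>
         (weakly_nondegenerate_on M A \<omega> H \<longleftrightarrow>
            smooth_module_hom M A (flat M A \<theta> \<omega>) \<and> flat_injective M A \<theta> \<omega>)"
proof -
  interpret convenient_mfd M A
    using assms(1) by unfold_locales
  have pair: "degenerate_pair (\<lambda>y. \<theta> p (tv p y)) (\<lambda>y z. \<omega> p (tv p y) (tv p z))" if "p \<in> M" for p
    using assms(4) that unfolding degenerate_def by (intro degenerate_pair_at assms(2,3)) blast+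
  have "tangent_bundle_direct_sum M A H V \<longleftrightarrow> weakly_nondegenerate_on M A \<omega> H"
    unfolding tangent_bundle_direct_sum_def weakly_nondegenerate_on_def H_def V_def
  \<comment> \<open>Both conditions quantify over the points of \<open>M\<close>, so it is enough to
    compare them on one fibre.\<close>
  proof (rule ball_cong[OF refl])
    fix p assume p: "p \<in> M"
    show "(tangent_space M A p =
         {tangent_add M A p h v |h v. h \<in> form_kernel1 M A \<theta> p \<and> v \<in> form_kernel2 M A \<omega> p} \<and>
       form_kernel1 M A \<theta> p \<inter> form_kernel2 M A \<omega> p = {tangent_zero M A p}) \<longleftrightarrow>
      {v \<in> form_kernel1 M A \<theta> p. \<forall>w\<in>form_kernel1 M A \<theta> p. \<omega> p v w = 0} = {tangent_zero M A p}"
      unfolding direct_sum_at_iff[OF assms(2,3) p] nondegenerate_at_iff[OF assms(2,3) p]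
      by (rule degenerate_pair.nondegenerate_ker_iff_direct_sum[OF pair[OF p], symmetric])
  qed
  moreover have "weakly_nondegenerate_on M A \<omega> H \<longleftrightarrow> flat_injective M A \<theta> \<omega>"
    unfolding flat_injective_iff weakly_nondegenerate_on_def H_def
  proof (rule ball_cong[OF refl])
    fix p assume p: "p \<in> M"
    show "{v \<in> form_kernel1 M A \<theta> p. \<forall>w\<in>form_kernel1 M A \<theta> p. \<omega> p v w = 0} = {tangent_zero M A p} \<longleftrightarrow>
      inj_on (flat_at M A \<theta> \<omega> p) (tangent_space M A p)"
      unfolding flat_at_inj_iff[OF assms(2,3) p] nondegenerate_at_iff[OF assms(2,3) p]
      by (rule degenerate_pair.nondegenerate_ker_iff_flat_inj[OF pair[OF p]])
  qed
  \<comment> \<open>What remains of (3), that \<open>flat\<close> is a homomorphism into the smooth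
    1-forms, holds for every such pair of forms.\<close>
  ultimately show ?thesis
    using flat_smooth_module_hom[OF assms(2,3)] by blast
qed

end
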